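(* The optimal robust price $p^*_{(\mu,q,\beta)}=\arg\sup_{p>0}\inf_{\mathbb{P}\in\mathcal{P}(\mu,q,\beta)}\mathrm{CR}(p,\mathbb{P})$ satisfies $$p^*_{(\mu,q,\beta)}\in\left\{\min\{\bar p_l,\hat p_l\},\ \max\{\bar p_h,\hat p_h\}\right\},$$ where (i) $\bar p_l$ is the left-most solution $p\in(0,\mu)$ of $p=\alpha(p)-\sqrt{\alpha(p)(\alpha(p)-\mu)}$; (ii) $\hat p_l\in(0,\mu)$ is the solution $p$ of $\dfrac{\alpha(p)^q-p^q}{\alpha(p)-p}=\dfrac{qs}{\mu}$; (iii) $\bar p_h$ is the right-most solution $p\in(0,\tau_2]$ of $\dfrac{\beta^q-p^q+\beta p^{q-1}}{2\beta-p}=\dfrac{s}{\mu}$ (if there is no such solution, $\max\{\bar p_h,\hat p_h\}$ is read as $\hat p_h$); (iv) $\hat p_h=\left(\dfrac{s}{q\mu}\right)^{\frac{1}{q-1}}$.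
   Context: Let $q>1$, $0<\mu<\beta<\infty$ and $s\in\mathbb{R}$. $\mathcal{P}(\mu,q,\beta)$ is the set of all probability distributions $\mathbb{P}$ of a real random variable $X$ with $\mathbb{P}(X\in[0,\beta])=1$, $\mathbb{E}_{\mathbb{P}}(X)=\mu$ and $\mathbb{E}_{\mathbb{P}}(X^q)=s$. Standing assumptions: $s>\mu^q$ and $\tau_2<\beta$, where $\tau_2=(s/\mu)^{1/(q-1)}$. For $p>0$, $\mathrm{CR}(p,\mathbb{P})=\dfrac{p\,\mathbb{P}(X\ge p)}{\sup_{t>0}t\,\mathbb{P}(X\ge t)}$. For $p\in(0,\mu)$, $\alpha(p)\in(\mu,\infty)$ denotes the unique solution of $$\alpha(p)^q\,\frac{\mu-p}{\alpha(p)-p}+p^q\,\frac{\alpha(p)-\mu}{\alpha(p)-p}=s,$$ i.e. the number such that there is a distribution supported on $\{p,\alpha(p)\}$ with mean $\mu$ and $q$-th moment $s$. *)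

theory Defs
  imports "HOL-Probability.Probability"
begin

definition ambiguity_set :: "real \<Rightarrow> real \<Rightarrow> real \<Rightarrow> real \<Rightarrow> real measure set"
  where "ambiguity_set \<mu> q \<beta> s =
    {M. real_distribution M \<and> measure M {0..\<beta>} = 1 \<and>
        (\<integral>x. x \<partial>M) = \<mu> \<and> (\<integral>x. x powr q \<partial>M) = s}"

definition CR :: "real \<Rightarrow> real measure \<Rightarrow> real"
  where "CR p M = p * measure M {p..} / (SUP t\<in>{0<..}. t * measure M {t..})"

definition worst_case_CR :: "real \<Rightarrow> real \<Rightarrow> real \<Rightarrow> real \<Rightarrow> real \<Rightarrow> real"
  where "worst_case_CR \<mu> q \<beta> s p = (INF M\<in>ambiguity_set \<mu> q \<beta> s. CR p M)"

definition optimal_robust_prices :: "real \<Rightarrow> real \<Rightarrow> real \<Rightarrow> real \<Rightarrow> real set"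
  where "optimal_robust_prices \<mu> q \<beta> s =
    {p. is_arg_max (worst_case_CR \<mu> q \<beta> s) (\<lambda>p. p > 0) p}"

definition tau2 :: "real \<Rightarrow> real \<Rightarrow> real \<Rightarrow> real"
  where "tau2 \<mu> q s = (s / \<mu>) powr (1 / (q - 1))"

(* Meaningful for 0 < p < \<mu> only. The value is not required to be at most \<beta>. *)
definition alpha :: "real \<Rightarrow> real \<Rightarrow> real \<Rightarrow> real \<Rightarrow> real"
  where "alpha \<mu> q s p = (THE a. a > \<mu> \<and>
    a powr q * ((\<mu> - p) / (a - p)) + p powr q * ((a - \<mu>) / (a - p)) = s)"

definition p_bar_l :: "real \<Rightarrow> real \<Rightarrow> real \<Rightarrow> real"
  where "p_bar_l \<mu> q s = (LEAST p. p \<in> {0<..<\<mu>} \<and>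
    p = alpha \<mu> q s p - sqrt (alpha \<mu> q s p * (alpha \<mu> q s p - \<mu>)))"

definition p_hat_l :: "real \<Rightarrow> real \<Rightarrow> real \<Rightarrow> real"
  where "p_hat_l \<mu> q s = (THE p. p \<in> {0<..<\<mu>} \<and>
    (alpha \<mu> q s p powr q - p powr q) / (alpha \<mu> q s p - p) = q * s / \<mu>)"

definition p_bar_h_eq :: "real \<Rightarrow> real \<Rightarrow> real \<Rightarrow> real \<Rightarrow> real \<Rightarrow> bool"
  where "p_bar_h_eq \<mu> q \<beta> s p \<longleftrightarrow> p \<in> {0<..tau2 \<mu> q s} \<and>
    (\<beta> powr q - p powr q + \<beta> * p powr (q - 1)) / (2 * \<beta> - p) = s / \<mu>"

definition p_bar_h :: "real \<Rightarrow> real \<Rightarrow> real \<Rightarrow> real \<Rightarrow> real"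
  where "p_bar_h \<mu> q \<beta> s = (GREATEST p. p_bar_h_eq \<mu> q \<beta> s p)"

definition p_hat_h :: "real \<Rightarrow> real \<Rightarrow> real \<Rightarrow> real"
  where "p_hat_h \<mu> q s = (s / (q * \<mu>)) powr (1 / (q - 1))"

(* max of p_bar_h and p_hat_h, read as p_hat_h if the equation for p_bar_h has no solution *)
definition high_price :: "real \<Rightarrow> real \<Rightarrow> real \<Rightarrow> real \<Rightarrow> real"
  where "high_price \<mu> q \<beta> s =
    (if \<exists>p. p_bar_h_eq \<mu> q \<beta> s p then max (p_bar_h \<mu> q \<beta> s) (p_hat_h \<mu> q s)
     else p_hat_h \<mu> q s)"

end

theory Submission
  imports Defs
begin

text \<open>Against a price \<open>p\<close> an adversary has two ways to lower the competitive ratio. It can hide mass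
just below \<open>p\<close>, so that the sales lost at \<open>p\<close> would be made at a slightly lower
price; or it can push the buying customers far above \<open>p\<close>, so that a much higher price would
sell to the same customers. Both effects are produced by the same extremal law, whose form depends
on whether the upper atom \<open>\<alpha>(p)\<close> fits below \<open>\<beta>\<close>.

If \<open>p < \<mu>\<close> and \<open>\<alpha>(p) \<le> \<beta>\<close>, the law is the two-point law on \<open>p\<close> (approached from below) and
\<open>\<alpha>(p)\<close>. With \<open>w(p) = (\<mu> - p) / (\<alpha>(p) - p)\<close> the weight of the upper atom, the worst case
is \<open>low_value p = min (p / \<alpha>(p)) (w(p))\<close>. Otherwise, for \<open>p \<le> \<tau>\<^sub>2\<close>, it is the law on
\<open>0\<close>, \<open>p\<close> (from below) and \<open>\<beta>\<close>, and the worst case is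
\<open>high_value p = min (p / \<beta>) (share p)\<close>, where \<open>share p\<close> is the fraction of the mass of the two
positive atoms that sits at \<open>\<beta>\<close>. From \<open>\<tau>\<^sub>2\<close> on the worst case is zero.

The upper bounds come from these laws, on the corresponding range of prices only
(\<open>worst_case_le_low_value\<close>, \<open>worst_case_le_high_value\<close>). The lower bounds come from weak duality
for moment problems: a combination of \<open>1\<close>, \<open>x\<close>, \<open>x\<^sup>q\<close> that dominates the relevant step function
pointwise is integrated. The dual functions stay valid outside the range where the primal law
exists, so \<open>low_value\<close> is a lower bound on all of \<open>(0, \<mu>)\<close> and \<open>high_value\<close> one on all of
\<open>(0, \<tau>\<^sub>2)\<close> (\<open>low_value_le_worst_case\<close>, \<open>high_value_le_worst_case\<close>). This asymmetry removes
every discussion of the price at which \<open>\<alpha>(p) = \<beta>\<close>.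

The low candidate is the strict global maximiser of \<open>low_value\<close>
(\<open>low_price_maximizes\<close>): \<open>w\<close> is strictly decreasing, \<open>p / \<alpha>(p)\<close> is unimodal with peak at the
price called \<open>p_hat_l\<close>, and \<open>p_bar_l\<close> is the first price at which the two terms meet. The high
candidate is the strict global maximiser of \<open>high_value\<close> (\<open>high_price_maximizes\<close>):
\<open>p / \<beta>\<close> increases, \<open>share\<close> is unimodal with peak \<open>p_hat_h\<close>, and \<open>p_bar_h\<close> is the last price
at which the two terms meet. Any other price \<open>p\<close> is therefore beaten: the formula that is exact
at \<open>p\<close> is smaller there than at its maximiser, where it still bounds the worst case from below.\<close>

section \<open>Strict convexity of powers\<close>

lemma powr_above_tangent:
  fixes q x y :: real
  assumes "q > 1" "0 \<le> x" "0 < y" "x \<noteq> y"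
  shows "y powr q + q * y powr (q - 1) * (x - y) < x powr q"
proof -
  have D: "((\<lambda>z. z powr q) has_real_derivative q * z powr (q - 1)) (at z)" if "z > 0" for z
    using that by (auto intro!: derivative_eq_intros)
  consider "x = 0" | "0 < x" "x < y" | "y < x" using assms by linarith
  then show ?thesis
  proof cases
    case 1
    have "y powr (q - 1) * y = y powr q" using assms by (simp add: powr_mult_base mult.commute)
    then have "q * y powr (q - 1) * (x - y) = - q * y powr q"
      using 1 by (simp add: mult.assoc)
    moreover have "q * y powr q > y powr q" using assms by simp
    moreover have "x powr q = 0" using 1 by simp
    ultimately show ?thesis by linarith
  next
    case 2
    obtain z where z: "x < z" "z < y" "y powr q - x powr q = (y - x) * (q * z powr (q - 1))"
      using MVT2[OF 2(2), of "\<lambda>z. z powr q" "\<lambda>z. q * z powr (q - 1)"] D 2 by force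
    have "q * z powr (q - 1) < q * y powr (q - 1)"
      using z 2 assms by (simp add: powr_less_mono2)
    then have "(y - x) * (q * z powr (q - 1)) < (y - x) * (q * y powr (q - 1))"
      using 2 by (simp only: mult_strict_left_mono diff_gt_0_iff_gt)
    then show ?thesis using z(3) by (simp add: algebra_simps)
  next
    case 3
    obtain z where z: "y < z" "z < x" "x powr q - y powr q = (x - y) * (q * z powr (q - 1))"
      using MVT2[OF 3, of "\<lambda>z. z powr q" "\<lambda>z. q * z powr (q - 1)"] D 3 assms by force
    have "q * y powr (q - 1) < q * z powr (q - 1)"
      using z assms by (simp add: powr_less_mono2)
    then have "(x - y) * (q * y powr (q - 1)) < (x - y) * (q * z powr (q - 1))"
      using 3 by (simp only: mult_strict_left_mono diff_gt_0_iff_gt)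
    then show ?thesis using z(3) by (simp add: algebra_simps)
  qed
qed

lemma powr_above_tangent_le:
  fixes q x y :: real
  assumes "q > 1" "0 \<le> x" "0 < y"
  shows "y powr q + q * y powr (q - 1) * (x - y) \<le> x powr q"
  using powr_above_tangent[OF assms] by (cases "x = y") auto

text \<open>The chord inequality is the convex combination of the tangent inequalities at the middle point, and
it is written without quotients so that it can be rearranged freely.\<close>

lemma powr_below_chord:
  fixes q x y z :: real
  assumes "q > 1" "0 \<le> x" "x < y" "y < z"
  shows "y powr q * (z - x) < x powr q * (z - y) + z powr q * (y - x)"
proof -
  define m where "m = q * y powr (q - 1)"
  have 1: "y powr q + m * (x - y) < x powr q" "y powr q + m * (z - y) < z powr q"
    using powr_above_tangent[of q x y] powr_above_tangent[of q z y] assms by (auto simp: m_def)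
  have "y powr q * (z - x) = (y powr q + m * (x - y)) * (z - y) + (y powr q + m * (z - y)) * (y - x)"
    by (simp add: algebra_simps)
  also have "\<dots> < x powr q * (z - y) + z powr q * (y - x)"
    using 1 assms by (intro add_strict_mono mult_strict_right_mono) auto
  finally show ?thesis .
qed

section \<open>Laws on at most three points\<close>

text \<open>The law is the image of a law on the indices \<open>0, 1, 2\<close>; indexing the atoms keeps the
statement valid when some of the three points coincide, so two-point laws are included.\<close>

lemma three_point_law:
  fixes x y z u v w :: real
  assumes "u \<ge> 0" "v \<ge> 0" "w \<ge> 0" "u + v + w = 1"
  obtains M :: "real measure" where "real_distribution M"
    and "\<And>h :: real \<Rightarrow> real. h \<in> borel_measurable borel \<Longrightarrow> (\<integral>r. h r \<partial>M) = u * h x + v * h y + w * h z"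
    and "\<And>A. A \<in> sets borel \<Longrightarrow>
           measure M A = u * indicator A x + v * indicator A y + w * indicator A z"
proof -
  define P where "P = pmf_of_list [(0::nat, u), (1, v), (2, w)]"
  define X where "X = (\<lambda>i::nat. if i = 0 then x else if i = 1 then y else z)"
  define M where "M = distr (measure_pmf P) borel X"
  have wf: "pmf_of_list_wf [(0::nat, u), (1, v), (2, w)]"
    using assms by (intro pmf_of_list_wfI) auto
  have supp: "set_pmf P \<subseteq> {0, 1, 2}"
    using set_pmf_of_list[OF wf] by (auto simp: P_def)
  have pmf: "pmf P 0 = u" "pmf P 1 = v" "pmf P 2 = w"
    using wf by (auto simp: P_def pmf_pmf_of_list)
  have "real_distribution M"
    unfolding real_distribution_def real_distribution_axioms_def M_def
    by (auto intro!: measure_pmf.prob_space_distr)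
  moreover have int: "(\<integral>r. h r \<partial>M) = u * h x + v * h y + w * h z"
    if "h \<in> borel_measurable borel" for h :: "real \<Rightarrow> real"
  proof -
    have "(\<integral>r. h r \<partial>M) = (\<integral>i. h (X i) \<partial>measure_pmf P)"
      using that unfolding M_def by (intro integral_distr) auto
    also have "\<dots> = (\<Sum>i\<in>{0, 1, 2}. h (X i) * pmf P i)"
      using supp by (intro integral_measure_pmf_real) auto
    also have "\<dots> = u * h x + v * h y + w * h z"
      using pmf by (simp add: X_def)
    finally show ?thesis .
  qed
  moreover have "measure M A = u * indicator A x + v * indicator A y + w * indicator A z"
    if "A \<in> sets borel" for A
  proof -
    have "measure M A = (\<integral>r. indicator A r \<partial>M)" using that by (simp add: M_def)
    then show ?thesis using int[of "indicator A"] that by simp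
  qed
  ultimately show ?thesis using that by blast
qed

section \<open>Two-point laws with prescribed moments\<close>

locale pricing_problem =
  fixes \<mu> q \<beta> s :: real
  assumes q_gt_1: "q > 1" and mu_pos: "0 < \<mu>" and mu_less_beta: "\<mu> < \<beta>"
    and s_gt: "s > \<mu> powr q" and tau2_less_beta: "tau2 \<mu> q s < \<beta>"
begin

abbreviation \<alpha> :: "real \<Rightarrow> real" where "\<alpha> \<equiv> alpha \<mu> q s"

abbreviation \<tau> :: real where "\<tau> \<equiv> tau2 \<mu> q s"

text \<open>The defining equation of \<open>\<alpha>(p)\<close> after clearing the denominator \<open>a - p\<close>: the sign of
\<open>excess p a\<close> tells whether the \<open>q\<close>-th moment of the law on \<open>{p, a}\<close> with mean \<open>\<mu>\<close> is above or
below \<open>s\<close>. In contrast to \<open>\<alpha>\<close> it is an explicit function, and every property of \<open>\<alpha>\<close> below is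
read off from its sign.\<close>

definition excess :: "real \<Rightarrow> real \<Rightarrow> real"
  where "excess p a = a powr q * (\<mu> - p) + p powr q * (a - \<mu>) - s * (a - p)"

definition top_weight :: "real \<Rightarrow> real"
  where "top_weight p = (\<mu> - p) / (\<alpha> p - p)"

lemma s_pos: "s > 0"
  using s_gt by (smt (verit) powr_ge_zero)

lemma powr_split: "x powr q = x * x powr (q - 1)" if "x \<ge> 0" for x :: real
  using powr_mult_base[of x "q - 1"] that by simp

lemma tau_powr: "\<tau> powr (q - 1) = s / \<mu>"
  using q_gt_1 mu_pos s_pos by (simp add: tau2_def powr_powr)

lemma tau_pos: "\<tau> > 0"
  using mu_pos s_pos by (simp add: tau2_def)

lemma mu_less_tau: "\<mu> < \<tau>"
proof -
  have "\<mu> powr (q - 1) < \<tau> powr (q - 1)"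
    using s_gt mu_pos powr_split[of \<mu>] by (simp add: tau_powr field_simps)
  then show ?thesis
    using q_gt_1 tau_pos mu_pos by (smt (verit) powr_mono2)
qed

lemma excess_alt: "excess p a = (\<mu> - p) * (a powr q - p powr q) - (s - p powr q) * (a - p)"
  by (simp add: excess_def algebra_simps)

text \<open>Up to a constant, \<open>excess p a / (a - p)\<close> is \<open>\<mu> - p\<close> times the slope of the chord of \<open>x\<^sup>q\<close> over
\<open>[p, a]\<close>, which increases with \<open>a\<close>. Hence \<open>excess p\<close> changes sign exactly once above \<open>\<mu>\<close>.\<close>

lemma excess_chord_mono:
  assumes "0 \<le> p" "p < \<mu>" "p < a" "a < b"
  shows "excess p a * (b - p) < excess p b * (a - p)"
proof -
  have "a powr q * (b - p) < p powr q * (b - a) + b powr q * (a - p)"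
    using powr_below_chord q_gt_1 assms by auto
  then have "(a powr q - p powr q) * (b - p) < (b powr q - p powr q) * (a - p)"
    by (simp add: algebra_simps)
  then have "(\<mu> - p) * ((a powr q - p powr q) * (b - p)) < (\<mu> - p) * ((b powr q - p powr q) * (a - p))"
    using assms by simp
  then show ?thesis unfolding excess_alt by (simp add: algebra_simps)
qed

lemma excess_at_mu: "p < \<mu> \<Longrightarrow> excess p \<mu> < 0"
proof -
  assume "p < \<mu>"
  have "excess p \<mu> = (\<mu> - p) * (\<mu> powr q - s)" unfolding excess_alt by (simp add: algebra_simps)
  with s_gt \<open>p < \<mu>\<close> show ?thesis by (simp add: mult_pos_neg)
qed

lemma excess_eventually_pos:
  assumes "0 < p" "p < \<mu>"
  obtains a where "\<mu> < a" "excess p a > 0"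
proof -
  define c where "c = (s / (\<mu> - p)) powr (1 / (q - 1))"
  define a where "a = max (2 * \<mu>) c"
  have "s / (\<mu> - p) = c powr (q - 1)"
    using q_gt_1 assms s_pos by (simp add: c_def powr_powr)
  also have "\<dots> \<le> a powr (q - 1)"
    using q_gt_1 by (intro powr_mono2) (auto simp: a_def c_def)
  finally have "s \<le> a powr (q - 1) * (\<mu> - p)"
    using assms by (simp add: field_simps)
  moreover have "a > \<mu>" using mu_pos by (simp add: a_def)
  ultimately have "s * a \<le> a powr q * (\<mu> - p)"
    using powr_split[of a] mu_pos by (simp add: mult.commute mult.left_commute)
  moreover have "p powr q * (a - \<mu>) \<ge> 0" "s * p > 0"
    using \<open>a > \<mu>\<close> s_pos assms by auto
  ultimately have "excess p a > 0" by (simp add: excess_def algebra_simps)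
  with \<open>a > \<mu>\<close> that show thesis by blast
qed

lemma alpha_ex1:
  assumes "0 < p" "p < \<mu>"
  shows "\<exists>!a. a > \<mu> \<and> excess p a = 0"
proof -
  obtain b where b: "\<mu> < b" "excess p b > 0" using excess_eventually_pos[OF assms] .
  have "continuous_on {\<mu>..b} (excess p)"
    unfolding excess_def using mu_pos by (auto intro!: continuous_intros)
  then obtain a where "\<mu> \<le> a" "excess p a = 0"
    using IVT'[of "excess p" \<mu> 0 b] excess_at_mu[of p] assms b by force
  moreover from this have "a \<noteq> \<mu>" using excess_at_mu[of p] assms by auto
  moreover have "a = a'" if "\<mu> < a" "excess p a = 0" "\<mu> < a'" "excess p a' = 0" for a a'
    using excess_chord_mono[of p a a'] excess_chord_mono[of p a' a] that assms
    by (cases a a' rule: linorder_cases) auto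
  ultimately show ?thesis by (metis order_le_imp_less_or_eq)
qed

lemma alpha_eq_excess: "\<alpha> p = (THE a. a > \<mu> \<and> excess p a = 0)" if "p < \<mu>"
proof -
  have "a powr q * ((\<mu> - p) / (a - p)) + p powr q * ((a - \<mu>) / (a - p)) = s \<longleftrightarrow> excess p a = 0"
    if "a > \<mu>" for a
  proof -
    have "a - p \<noteq> 0" using that \<open>p < \<mu>\<close> by simp
    then show ?thesis by (simp add: excess_def add_divide_distrib[symmetric] divide_eq_eq)
  qed
  then have "(\<lambda>a. a > \<mu> \<and> a powr q * ((\<mu> - p) / (a - p)) + p powr q * ((a - \<mu>) / (a - p)) = s)
           = (\<lambda>a. a > \<mu> \<and> excess p a = 0)" by blast
  then show ?thesis unfolding alpha_def by simp
qed

lemma alpha_gt_mu: "\<alpha> p > \<mu>" and excess_alpha: "excess p (\<alpha> p) = 0" if "0 < p" "p < \<mu>"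
  using theI'[OF alpha_ex1[OF that]] alpha_eq_excess that by auto

lemma excess_sign:
  assumes "0 < p" "p < \<mu>" "\<mu> < a"
  shows "excess p a < 0 \<longleftrightarrow> a < \<alpha> p" and "excess p a > 0 \<longleftrightarrow> a > \<alpha> p"
proof -
  note al = alpha_gt_mu[OF assms(1,2)] excess_alpha[OF assms(1,2)]
  have lt: "excess p a < 0" if "a < \<alpha> p"
    using excess_chord_mono[of p a "\<alpha> p"] that al assms by (simp add: mult_less_0_iff)
  have gt: "excess p a > 0" if "\<alpha> p < a"
    using excess_chord_mono[of p "\<alpha> p" a] that al assms by (simp add: zero_less_mult_iff)
  show "excess p a < 0 \<longleftrightarrow> a < \<alpha> p" "excess p a > 0 \<longleftrightarrow> a > \<alpha> p"
    using lt gt al by (cases a "\<alpha> p" rule: linorder_cases; force)+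
qed

text \<open>In its first argument \<open>excess\<close> is convex with the trivial zero \<open>u = a\<close>, so a nonpositive value
forces negative values from there up to \<open>a\<close>.\<close>

lemma excess_neg_between:
  assumes "0 \<le> u" "u < p" "p < a" "\<mu> < a" "excess u a \<le> 0"
  shows "excess p a < 0"
proof -
  have "p powr q * (a - u) < u powr q * (a - p) + a powr q * (p - u)"
    using powr_below_chord q_gt_1 assms by auto
  then have "(a - \<mu>) * (p powr q * (a - u)) < (a - \<mu>) * (u powr q * (a - p) + a powr q * (p - u))"
    using assms by simp
  then have "excess p a * (a - u) < excess u a * (a - p)"
    unfolding excess_def by (simp add: algebra_simps)
  also have "\<dots> \<le> 0" using assms by (simp add: mult_nonpos_nonneg)
  finally show ?thesis using assms by (simp add: mult_less_0_iff)
qed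

lemma excess_neg_above_mu:
  assumes "\<mu> \<le> p" "p < a"
  shows "excess p a < 0"
proof -
  have *: "excess \<mu> a < 0" using s_gt assms by (simp add: excess_alt)
  then show ?thesis
    using excess_neg_between[of \<mu> p a] mu_pos assms by (cases "p = \<mu>") auto
qed

lemma alpha_strict_mono:
  assumes "0 < u" "u < p" "p < \<mu>"
  shows "\<alpha> u < \<alpha> p"
proof -
  have "\<mu> < \<alpha> u" "excess u (\<alpha> u) = 0" using alpha_gt_mu excess_alpha assms by auto
  then have "excess p (\<alpha> u) < 0" using excess_neg_between[of u p "\<alpha> u"] assms by auto
  then show ?thesis using excess_sign(1)[of p "\<alpha> u"] \<open>\<mu> < \<alpha> u\<close> assms by auto
qed

text \<open>The sets where \<open>\<alpha>\<close> lies below or above a given level are sign conditions on the continuous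
function \<open>excess\<close>, hence open; no implicit function theorem is involved.\<close>

lemma isCont_alpha:
  assumes "0 < p" "p < \<mu>"
  shows "isCont \<alpha> p"
  unfolding isCont_def
proof (rule order_tendstoI)
  have ev: "eventually (\<lambda>x. 0 < x \<and> x < \<mu>) (at p)"
    using eventually_at_in_open'[of "{0<..<\<mu>}" p] assms by simp
  have cont: "((\<lambda>x. excess x a) \<longlongrightarrow> excess p a) (at p)" for a
    unfolding excess_def using assms by (auto intro!: tendsto_eq_intros)
  {
    fix a assume a: "a < \<alpha> p"
    define b where "b = max a ((\<mu> + \<alpha> p) / 2)"
    have b: "\<mu> < b" "b < \<alpha> p" "a \<le> b"
      using a alpha_gt_mu[OF assms] by (auto simp: b_def max_def)
    then have "excess p b < 0" using excess_sign assms by auto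
    then have "eventually (\<lambda>x. excess x b < 0) (at p)"
      using cont order_tendstoD(2) by blast
    with ev show "eventually (\<lambda>x. a < \<alpha> x) (at p)"
      by eventually_elim (use b excess_sign in fastforce)
  next
    fix a assume a: "\<alpha> p < a"
    then have "\<mu> < a" using alpha_gt_mu[OF assms] by simp
    then have "excess p a > 0" using excess_sign assms a by auto
    then have "eventually (\<lambda>x. excess x a > 0) (at p)"
      using cont order_tendstoD(1) by blast
    with ev show "eventually (\<lambda>x. \<alpha> x < a) (at p)"
      by eventually_elim (use \<open>\<mu> < a\<close> excess_sign in fastforce)
  }
qed

lemma two_point_moments:
  assumes "0 < p" "p < \<mu>"
  shows "0 < top_weight p" "top_weight p < 1"
    "top_weight p * \<alpha> p + (1 - top_weight p) * p = \<mu>"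
    "top_weight p * \<alpha> p powr q + (1 - top_weight p) * p powr q = s"
proof -
  note al = alpha_gt_mu[OF assms] excess_alpha[OF assms]
  have w: "top_weight p * (\<alpha> p - p) = \<mu> - p" using al assms by (simp add: top_weight_def)
  show "0 < top_weight p" "top_weight p < 1" using al assms by (auto simp: top_weight_def)
  show "top_weight p * \<alpha> p + (1 - top_weight p) * p = \<mu>" using w by (simp add: algebra_simps)
  have "(top_weight p * (\<alpha> p - p)) * (\<alpha> p powr q - p powr q) = (s - p powr q) * (\<alpha> p - p)"
    using al(2) w by (simp add: excess_alt)
  then have "(top_weight p * (\<alpha> p powr q - p powr q) - (s - p powr q)) * (\<alpha> p - p) = 0"
    by (simp add: algebra_simps)
  moreover have "\<alpha> p - p \<noteq> 0" using al assms by simp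
  ultimately have "top_weight p * (\<alpha> p powr q - p powr q) - (s - p powr q) = 0"
    by (metis mult_eq_0_iff)
  then show "top_weight p * \<alpha> p powr q + (1 - top_weight p) * p powr q = s"
    by (simp add: algebra_simps)
qed

lemma isCont_top_weight:
  assumes "0 < p" "p < \<mu>"
  shows "isCont top_weight p"
  unfolding top_weight_def
  using isCont_alpha[OF assms] alpha_gt_mu[OF assms] assms by (auto intro!: continuous_intros)

section \<open>Revenue guarantee of the two-point laws\<close>

definition low_value :: "real \<Rightarrow> real"
  where "low_value p = min (p / \<alpha> p) (top_weight p)"

text \<open>The height of \<open>x\<^sup>q\<close> above its tangent at \<open>a\<close>. For \<open>a = \<alpha>(p)\<close> it is, up to scaling, the
slack of the dual function that certifies the smallest possible mass above \<open>p\<close>.\<close>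

definition tangent_gap :: "real \<Rightarrow> real \<Rightarrow> real"
  where "tangent_gap a x = x powr q - (a powr q + q * a powr (q - 1) * (x - a))"

lemma tangent_gap_nonneg: "0 \<le> tangent_gap a x" if "0 \<le> x" "0 < a"
  using powr_above_tangent_le[OF q_gt_1 that] by (simp add: tangent_gap_def)

lemma tangent_gap_pos: "0 < tangent_gap a x" if "0 \<le> x" "0 < a" "x \<noteq> a"
  using powr_above_tangent[OF q_gt_1 that] by (simp add: tangent_gap_def)

lemma tangent_gap_antimono:
  assumes "0 \<le> x" "x \<le> y" "0 < y" "y \<le> a"
  shows "tangent_gap a y \<le> tangent_gap a x"
proof -
  have "y powr (q - 1) \<le> a powr (q - 1)" using assms q_gt_1 by (intro powr_mono2) auto
  then have "(a powr (q - 1) - y powr (q - 1)) * (y - x) * q \<ge> 0" using assms q_gt_1 by simp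
  moreover have "y powr q + q * y powr (q - 1) * (x - y) \<le> x powr q"
    using powr_above_tangent_le[OF q_gt_1] assms by auto
  ultimately show ?thesis unfolding tangent_gap_def by (simp add: algebra_simps)
qed

text \<open>The left-hand side is the integral of \<open>tangent_gap (\<alpha> p)\<close> under any law with the given moments,
evaluated on the two-point law, where only the lower atom contributes.\<close>

lemma tangent_gap_mean:
  assumes "0 < p" "p < \<mu>"
  shows "s - (\<alpha> p powr q + q * \<alpha> p powr (q - 1) * (\<mu> - \<alpha> p))
       = (1 - top_weight p) * tangent_gap (\<alpha> p) p"
proof -
  define c where "c = \<alpha> p powr q + q * \<alpha> p powr (q - 1) * (\<mu> - \<alpha> p)"
  have mu: "\<mu> - \<alpha> p = (1 - top_weight p) * (p - \<alpha> p)"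
    using two_point_moments(3)[OF assms] by (simp add: algebra_simps)
  have "c = \<alpha> p powr q + q * \<alpha> p powr (q - 1) * ((1 - top_weight p) * (p - \<alpha> p))"
    unfolding c_def mu ..
  then have "(top_weight p * \<alpha> p powr q + (1 - top_weight p) * p powr q) - c
      = (1 - top_weight p) * tangent_gap (\<alpha> p) p"
    by (simp add: tangent_gap_def algebra_simps)
  then show ?thesis using two_point_moments(4)[OF assms] by (simp add: c_def)
qed

text \<open>Integrating the tangent gap at \<open>\<alpha>(p)\<close> over the law on \<open>{u, \<alpha>(u)}\<close> gives the same value as
over the law on \<open>{p, \<alpha>(p)}\<close>. The atom \<open>u\<close> lies farther out than \<open>p\<close>, where the gap is larger, and
\<open>\<alpha>(u)\<close> contributes a positive amount as well; so the lower atom must weigh less.\<close>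

lemma top_weight_strict_antimono:
  assumes "0 < u" "u < p" "p < \<mu>"
  shows "top_weight p < top_weight u"
proof -
  let ?a = "\<alpha> p" and ?w = "top_weight u"
  note u = two_point_moments[of u] and p = two_point_moments[of p]
  have a: "\<mu> < ?a" "?a \<noteq> \<alpha> u" "\<mu> < \<alpha> u"
    using alpha_gt_mu alpha_strict_mono[of u p] assms by (auto simp: less_imp_neq)
  have "(1 - ?w) * tangent_gap ?a u + ?w * tangent_gap ?a (\<alpha> u)
      = (?w * \<alpha> u powr q + (1 - ?w) * u powr q) -
        (?a powr q + q * ?a powr (q - 1) * ((?w * \<alpha> u + (1 - ?w) * u) - ?a))"
    by (simp add: tangent_gap_def algebra_simps)
  also have "\<dots> = (1 - top_weight p) * tangent_gap ?a p"
    using u(3,4) tangent_gap_mean[of p] assms by simp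
  finally have eq: "(1 - ?w) * tangent_gap ?a u + ?w * tangent_gap ?a (\<alpha> u)
      = (1 - top_weight p) * tangent_gap ?a p" .
  have "?w * tangent_gap ?a (\<alpha> u) > 0"
    using tangent_gap_pos[of "\<alpha> u" ?a] a mu_pos u(1) assms by auto
  moreover have "(1 - ?w) * tangent_gap ?a u \<ge> (1 - ?w) * tangent_gap ?a p"
    using tangent_gap_antimono[of u p ?a] a u(2) assms by (intro mult_left_mono) auto
  ultimately have "(1 - ?w) * tangent_gap ?a p < (1 - top_weight p) * tangent_gap ?a p"
    using eq by linarith
  moreover have "tangent_gap ?a p > 0" using tangent_gap_pos[of p ?a] a assms by auto
  ultimately show ?thesis by (simp add: mult_less_cancel_right)
qed

text \<open>On the two-point law the chord slope in the equation for \<open>p_hat_l\<close> equals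
\<open>(s - p\<^sup>q) / (\<mu> - p)\<close>, since the chord passes through \<open>(\<mu>, s)\<close>. That equation is thus free of
\<open>\<alpha>\<close>; this is its difference with denominators cleared, a strictly concave function of \<open>p\<close>.\<close>

definition stationarity :: "real \<Rightarrow> real"
  where "stationarity p = \<mu> * (s - p powr q) - q * s * (\<mu> - p)"

lemma stationarity_iff:
  assumes "0 < p" "p < \<mu>"
  shows "(\<alpha> p powr q - p powr q) / (\<alpha> p - p) = q * s / \<mu> \<longleftrightarrow> stationarity p = 0"
proof -
  have "(\<mu> - p) * (\<alpha> p powr q - p powr q) = (s - p powr q) * (\<alpha> p - p)"
    using excess_alpha[OF assms] by (simp add: excess_alt)
  moreover have "\<alpha> p - p \<noteq> 0" "\<mu> - p \<noteq> 0" using alpha_gt_mu[OF assms] assms by auto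
  ultimately have "(\<alpha> p powr q - p powr q) / (\<alpha> p - p) = (s - p powr q) / (\<mu> - p)"
    by (simp add: field_simps)
  moreover have "(s - p powr q) / (\<mu> - p) = q * s / \<mu> \<longleftrightarrow> stationarity p = 0"
    using assms mu_pos by (auto simp add: stationarity_def field_simps)
  ultimately show ?thesis by simp
qed

text \<open>A concave function that is negative at \<open>0\<close> and positive at \<open>\<mu>\<close> has one zero between them, and
changes sign there.\<close>

lemma p_hat_l_props:
  shows "0 < p_hat_l \<mu> q s" "p_hat_l \<mu> q s < \<mu>"
    and "\<And>p. 0 < p \<Longrightarrow> p \<le> p_hat_l \<mu> q s \<Longrightarrow> stationarity p \<le> 0"
    and "\<And>p. p_hat_l \<mu> q s \<le> p \<Longrightarrow> p < \<mu> \<Longrightarrow> stationarity p \<ge> 0"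
proof -
  have st0: "stationarity 0 < 0"
    using mu_pos s_pos q_gt_1 by (simp add: stationarity_def)
  have stmu: "stationarity \<mu> > 0"
    using mu_pos s_gt by (simp add: stationarity_def)
  have concave: "stationarity u * (b - y) + stationarity b * (y - u) < stationarity y * (b - u)"
    if "0 \<le> u" "u < y" "y < b" for u y b
  proof -
    have "y powr q * (b - u) < u powr q * (b - y) + b powr q * (y - u)"
      using powr_below_chord q_gt_1 that by auto
    then have "\<mu> * (y powr q * (b - u)) < \<mu> * (u powr q * (b - y) + b powr q * (y - u))"
      using mu_pos by simp
    then show ?thesis unfolding stationarity_def by (simp add: algebra_simps)
  qed
  have "continuous_on {0..\<mu>} stationarity"
    unfolding stationarity_def using q_gt_1 by (auto intro!: continuous_intros continuous_on_powr')
  then obtain z where "0 \<le> z" "z \<le> \<mu>" and z0: "stationarity z = 0"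
    using IVT'[of stationarity 0 0 \<mu>] st0 stmu mu_pos by auto
  then have z: "0 < z" "z < \<mu>" using st0 stmu by (auto simp: order_less_le)
  have below: "stationarity p < 0" if "0 < p" "p < z" for p
  proof -
    have "stationarity p * (\<mu> - z) + stationarity \<mu> * (z - p) < 0"
      using concave[of p z \<mu>] that z z0 by simp
    moreover have "stationarity \<mu> * (z - p) > 0" using stmu that by simp
    ultimately show ?thesis using z by (smt (verit) mult_nonneg_nonneg)
  qed
  have above: "stationarity p > 0" if "z < p" "p < \<mu>" for p
  proof -
    have "stationarity \<mu> * (p - z) < stationarity p * (\<mu> - z)"
      using concave[of z p \<mu>] that z z0 by simp
    moreover have "stationarity \<mu> * (p - z) > 0" using stmu that by simp
    ultimately show ?thesis using z by (smt (verit) mult_nonpos_nonneg)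
  qed
  have "p_hat_l \<mu> q s = z"
    unfolding p_hat_l_def
  proof (rule the_equality)
    show "z \<in> {0<..<\<mu>} \<and> (\<alpha> z powr q - z powr q) / (\<alpha> z - z) = q * s / \<mu>"
      using z z0 stationarity_iff by simp
    fix p assume p: "p \<in> {0<..<\<mu>} \<and> (\<alpha> p powr q - p powr q) / (\<alpha> p - p) = q * s / \<mu>"
    then have "stationarity p = 0" using stationarity_iff[of p] by auto
    with below[of p] above[of p] p show "p = z" by (cases p z rule: linorder_cases) auto
  qed
  with z z0 below above show "0 < p_hat_l \<mu> q s" "p_hat_l \<mu> q s < \<mu>"
    "\<And>p. 0 < p \<Longrightarrow> p \<le> p_hat_l \<mu> q s \<Longrightarrow> stationarity p \<le> 0"
    "\<And>p. p_hat_l \<mu> q s \<le> p \<Longrightarrow> p < \<mu> \<Longrightarrow> stationarity p \<ge> 0"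
    by (auto simp: order_le_less)
qed

text \<open>This is the unimodality of \<open>p / \<alpha>(p)\<close>, obtained by scaling instead of differentiating \<open>\<alpha>\<close>.
Scale both atoms of the law at \<open>p\<close> by \<open>k = u / p\<close>. The ratio of the atoms is kept, and it exceeds
\<open>u / \<alpha>(u)\<close> precisely if the scaled upper atom lies below \<open>\<alpha>(u)\<close>, that is, if the excess of the
scaled pair is negative. That excess is \<open>k\<close> times \<open>k\<^sup>q\<^sup>-\<^sup>1 X - k\<^sup>q Y - (X - Y)\<close>, which vanishes at
\<open>k = 1\<close> and has a derivative there whose sign is opposite to \<open>stationarity p\<close>; Bernoulli's
inequality extends the first-order information to all \<open>k\<close> on the relevant side.\<close>

lemma scaled_ratio_less:
  assumes p: "0 < p" "p < \<mu>" and u: "0 < u" "u < \<mu>" "u \<noteq> p"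
    and side: "u < p \<and> stationarity p \<le> 0 \<or> p < u \<and> stationarity p \<ge> 0"
  shows "u / \<alpha> u < p / \<alpha> p"
proof -
  let ?a = "\<alpha> p"
  note al = alpha_gt_mu[OF p] excess_alpha[OF p]
  define k where "k = u / p"
  have k: "k > 0" "k \<noteq> 1" "u = k * p" using p u by (auto simp: k_def)
  define X where "X = \<mu> * (?a powr q - p powr q)"
  define Y where "Y = p * ?a powr q - ?a * p powr q"
  have XY: "X - Y = s * (?a - p)"
    using al(2) by (simp add: X_def Y_def excess_def algebra_simps)
  have Ypos: "Y > 0"
  proof -
    have "p powr (q - 1) < ?a powr (q - 1)" using al p q_gt_1 by (intro powr_less_mono2) auto
    then have "p * ?a * p powr (q - 1) < p * ?a * ?a powr (q - 1)" using al p by simp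
    then show ?thesis using powr_split[of p] powr_split[of ?a] al p by (simp add: Y_def algebra_simps)
  qed
  \<comment> \<open>The factor \<open>(q - 1) X - q Y\<close> is the derivative of the scaled excess in \<open>k\<close> at \<open>1\<close>.\<close>
  have slope: "((q - 1) * X - q * Y) * (\<mu> - p) = - (stationarity p * (?a - p))"
  proof -
    have X: "X * (\<mu> - p) = \<mu> * ((s - p powr q) * (?a - p))"
      using al(2) by (simp add: X_def excess_alt mult.commute mult.left_commute)
    have "(q - 1) * X - q * Y = q * (X - Y) - X" by (simp add: algebra_simps)
    then have "((q - 1) * X - q * Y) * (\<mu> - p) = q * (s * (?a - p)) * (\<mu> - p) - X * (\<mu> - p)"
      by (simp only: XY left_diff_distrib)
    then show ?thesis unfolding X stationarity_def by (simp add: algebra_simps)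
  qed
  \<comment> \<open>Bernoulli's inequality for \<open>1 / k\<close>, multiplied by \<open>k\<^sup>q\<close>.\<close>
  have bern: "(q - 1) * (1 - k powr q) < q * (1 - k powr (q - 1))"
  proof -
    have "1 + q * (1 / k - 1) < (1 / k) powr q"
      using powr_above_tangent[of q "1 / k" 1] q_gt_1 k by simp
    then have "(1 + q * (1 / k - 1)) * k powr q < (1 / k) powr q * k powr q"
      using k by simp
    also have "\<dots> = 1" using k by (simp add: powr_divide)
    finally have "(1 + q * (1 / k - 1)) * k powr q < 1" .
    moreover have "1 / k * k powr q = k powr (q - 1)" using k powr_split[of k] by simp
    moreover have "(1 + q * (1 / k - 1)) * k powr q = k powr q + q * (1 / k * k powr q) - q * k powr q"
      by (simp add: algebra_simps)
    ultimately show ?thesis by (simp add: algebra_simps)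
  qed
  have key: "k powr (q - 1) * X - k powr q * Y < X - Y"
  proof -
    have "(q - 1) * ((1 - k powr q) * Y) < q * (1 - k powr (q - 1)) * Y"
      using bern Ypos by simp
    also have "\<dots> \<le> (q - 1) * ((1 - k powr (q - 1)) * X)"
    proof (cases "k < 1")
      case True
      then have "u < p" using k p by simp
      then have "stationarity p \<le> 0" using side by simp
      then have "(q - 1) * X - q * Y \<ge> 0"
        using slope p al by (smt (verit) mult_nonneg_nonneg mult_nonpos_nonneg mult_neg_pos)
      moreover have "k powr (q - 1) \<le> 1" using True k q_gt_1 by (simp add: powr_le1)
      ultimately have "((q - 1) * X - q * Y) * (1 - k powr (q - 1)) \<ge> 0" by simp
      then show ?thesis by (simp add: algebra_simps)
    next
      case False
      then have "p < u" using k p by simp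
      then have "stationarity p \<ge> 0" using side by simp
      then have "(q - 1) * X - q * Y \<le> 0"
        using slope p al by (smt (verit) mult_nonneg_nonneg mult_pos_pos)
      moreover have "k powr (q - 1) \<ge> 1" using False k q_gt_1 by (simp add: ge_one_powr_ge_zero)
      ultimately have "((q - 1) * X - q * Y) * (1 - k powr (q - 1)) \<ge> 0"
        by (simp add: mult_nonpos_nonpos)
      then show ?thesis by (simp add: algebra_simps)
    qed
    finally have "(1 - k powr q) * Y < (1 - k powr (q - 1)) * X"
      using q_gt_1 by simp
    then show ?thesis by (simp add: algebra_simps)
  qed
  have "excess u (k * ?a) = k * (k powr (q - 1) * X - k powr q * Y - (X - Y))"
    unfolding XY using k p al mu_pos powr_split[of k]
    by (simp add: excess_def X_def Y_def powr_mult algebra_simps)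
  then have "excess u (k * ?a) < 0" using key k by (simp add: mult_pos_neg)
  then have "k * ?a < \<alpha> u"
    using excess_sign(1)[of u "k * ?a"] alpha_gt_mu[of u] u by (cases "\<mu> < k * ?a") auto
  then have "k * p * ?a < \<alpha> u * p" using p by (simp add: mult.commute mult.left_commute)
  then show ?thesis using k al alpha_gt_mu[of u] u mu_pos by (simp add: field_simps)
qed

text \<open>The sign of \<open>p / \<alpha>(p) - w(p)\<close> with denominators cleared.\<close>

definition crossing :: "real \<Rightarrow> real"
  where "crossing p = p * (2 * \<alpha> p - p) - \<mu> * \<alpha> p"

lemma crossing_sign:
  assumes "0 < p" "p < \<mu>"
  shows "crossing p \<le> 0 \<longleftrightarrow> p / \<alpha> p \<le> top_weight p"
    and "crossing p = 0 \<longleftrightarrow> p = \<alpha> p - sqrt (\<alpha> p * (\<alpha> p - \<mu>))"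
proof -
  note al = alpha_gt_mu[OF assms]
  have "p / \<alpha> p \<le> top_weight p \<longleftrightarrow> p * (\<alpha> p - p) \<le> (\<mu> - p) * \<alpha> p"
    using al assms mu_pos by (simp add: top_weight_def field_simps)
  then show "crossing p \<le> 0 \<longleftrightarrow> p / \<alpha> p \<le> top_weight p"
    by (simp add: crossing_def algebra_simps)
  have "p = \<alpha> p - sqrt (\<alpha> p * (\<alpha> p - \<mu>)) \<longleftrightarrow> sqrt (\<alpha> p * (\<alpha> p - \<mu>)) = \<alpha> p - p" by auto
  also have "\<dots> \<longleftrightarrow> \<alpha> p * (\<alpha> p - \<mu>) = (\<alpha> p - p)\<^sup>2"
  proof
    show "\<alpha> p * (\<alpha> p - \<mu>) = (\<alpha> p - p)\<^sup>2" if "sqrt (\<alpha> p * (\<alpha> p - \<mu>)) = \<alpha> p - p"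
      using al mu_pos by (simp add: that[symmetric])
    show "sqrt (\<alpha> p * (\<alpha> p - \<mu>)) = \<alpha> p - p" if "\<alpha> p * (\<alpha> p - \<mu>) = (\<alpha> p - p)\<^sup>2"
      using al assms unfolding that by simp
  qed
  finally show "crossing p = 0 \<longleftrightarrow> p = \<alpha> p - sqrt (\<alpha> p * (\<alpha> p - \<mu>))"
    by (auto simp: crossing_def power2_eq_square algebra_simps)
qed

lemma isCont_crossing: "isCont crossing p" if "0 < p" "p < \<mu>"
  unfolding crossing_def using isCont_alpha[OF that] by (auto intro!: continuous_intros)

lemma crossing_neg_below_half: "crossing p < 0" if "0 < p" "p \<le> \<mu> / 2"
proof -
  have "p < \<mu>" using that mu_pos by simp
  then have "2 * p * \<alpha> p \<le> \<mu> * \<alpha> p" using alpha_gt_mu[of p] that mu_pos by simp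
  moreover have "p * p > 0" using that by simp
  ultimately show ?thesis unfolding crossing_def by (simp add: algebra_simps)
qed

text \<open>As \<open>p\<close> tends to \<open>\<mu>\<close>, \<open>crossing p\<close> is in the limit at least \<open>\<mu> (a - \<mu>)\<close> for any lower bound \<open>a\<close> of
\<open>\<alpha>(p)\<close>; monotonicity provides the bound \<open>a = \<alpha>(\<mu> / 2) > \<mu>\<close>. The witness solves
\<open>a (2 p - \<mu>) = \<mu>\<^sup>2\<close>.\<close>

lemma crossing_eventually_pos:
  obtains p where "\<mu> / 2 < p" "p < \<mu>" "crossing p > 0"
proof -
  define a where "a = \<alpha> (\<mu> / 2)"
  have a: "a > \<mu>" using alpha_gt_mu[of "\<mu> / 2"] mu_pos by (simp add: a_def)
  define p where "p = \<mu> * (a + \<mu>) / (2 * a)"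
  have p: "\<mu> / 2 < p" "p < \<mu>" using a mu_pos by (auto simp: p_def field_simps)
  have "a * (2 * p - \<mu>) = \<mu> * \<mu>" using a mu_pos by (simp add: p_def field_simps)
  moreover have "a < \<alpha> p" using alpha_strict_mono[of "\<mu> / 2" p] p mu_pos by (simp add: a_def)
  then have "a * (2 * p - \<mu>) < \<alpha> p * (2 * p - \<mu>)" using p by simp
  moreover have "p * p < \<mu> * \<mu>" using p mu_pos by (intro mult_strict_mono) auto
  ultimately have "crossing p > 0" by (simp add: crossing_def algebra_simps)
  with p that show thesis by blast
qed

text \<open>The leftmost solution exists because the solutions in a compact subinterval of \<open>(0, \<mu>)\<close> form a
compact set and there are none in \<open>(0, \<mu> / 2]\<close>. Before it, \<open>p / \<alpha>(p)\<close> is the smaller of the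
two terms of \<open>low_value\<close>.\<close>

lemma p_bar_l_props:
  shows "0 < p_bar_l \<mu> q s" "p_bar_l \<mu> q s < \<mu>" "crossing (p_bar_l \<mu> q s) = 0"
    and "\<And>p. 0 < p \<Longrightarrow> p \<le> p_bar_l \<mu> q s \<Longrightarrow> crossing p \<le> 0"
proof -
  obtain b where b: "\<mu> / 2 < b" "b < \<mu>" "crossing b > 0" using crossing_eventually_pos .
  have half: "crossing (\<mu> / 2) < 0" using crossing_neg_below_half[of "\<mu> / 2"] mu_pos by simp
  have cont: "continuous_on {\<mu> / 2..c} crossing" if "c < \<mu>" for c
    using that mu_pos by (intro continuous_at_imp_continuous_on) (auto intro!: isCont_crossing)
  have zero: "\<exists>x. \<mu> / 2 \<le> x \<and> x \<le> c \<and> crossing x = 0" if "\<mu> / 2 \<le> c" "c < \<mu>" "crossing c \<ge> 0" for c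
    using IVT'[of crossing "\<mu> / 2" 0 c] half that cont[of c] by force
  define Z where "Z = {x \<in> {\<mu> / 2..b}. crossing x = 0}"
  have "closed Z"
    unfolding Z_def using cont[OF b(2)] by (intro continuous_closed_preimage_constant) auto
  then have "compact Z"
    by (metis (no_types, lifting) Z_def bounded_closed_interval bounded_subset compact_eq_bounded_closed mem_Collect_eq subsetI)
  moreover have "Z \<noteq> {}" using zero[of b] b by (auto simp: Z_def)
  ultimately obtain z where z: "z \<in> Z" "\<And>y. y \<in> Z \<Longrightarrow> z \<le> y"
    using compact_attains_inf by metis
  have z': "0 < z" "z < \<mu>" "crossing z = 0" "\<mu> / 2 \<le> z" "z \<le> b" using z(1) b mu_pos by (auto simp: Z_def)
  have least: "z \<le> x" if "0 < x" "x < \<mu>" "crossing x = 0" for x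
    using z(2)[of x] that crossing_neg_below_half[of x] z'
    by (cases "x \<le> b"; cases "x \<le> \<mu> / 2") (auto simp: Z_def)
  have "p_bar_l \<mu> q s = z"
    unfolding p_bar_l_def
  proof (rule Least_equality)
    show "z \<in> {0<..<\<mu>} \<and> z = \<alpha> z - sqrt (\<alpha> z * (\<alpha> z - \<mu>))"
      using z' crossing_sign(2)[of z] by simp
    show "z \<le> y" if "y \<in> {0<..<\<mu>} \<and> y = \<alpha> y - sqrt (\<alpha> y * (\<alpha> y - \<mu>))" for y
      using that least[of y] crossing_sign(2)[of y] by simp
  qed
  moreover have "crossing p \<le> 0" if "0 < p" "p \<le> z" for p
  proof (rule ccontr)
    assume "\<not> crossing p \<le> 0"
    moreover from this have "\<mu> / 2 < p" using crossing_neg_below_half[of p] that by force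
    moreover have "p < \<mu>" using that z' by simp
    ultimately obtain x where "\<mu> / 2 \<le> x" "x \<le> p" "crossing x = 0" using zero[of p] by auto
    then have "z \<le> x" using least[of x] mu_pos \<open>p < \<mu>\<close> by simp
    then have "p = z" using \<open>x \<le> p\<close> that by simp
    then show False using \<open>\<not> crossing p \<le> 0\<close> z' by simp
  qed
  ultimately show "0 < p_bar_l \<mu> q s" "p_bar_l \<mu> q s < \<mu>" "crossing (p_bar_l \<mu> q s) = 0"
    "\<And>p. 0 < p \<Longrightarrow> p \<le> p_bar_l \<mu> q s \<Longrightarrow> crossing p \<le> 0"
    using z' by auto
qed

text \<open>Up to \<open>pl\<close> the value is the increasing branch of \<open>p / \<alpha>(p)\<close>. If \<open>p_hat_l\<close> comes first, \<open>pl\<close> is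
the peak of \<open>p / \<alpha>(p)\<close> and that term alone bounds all other prices. If the crossing comes first,
both terms agree at \<open>pl\<close> and afterwards the decreasing weight is the bound.\<close>

lemma low_price_maximizes:
  defines "pl \<equiv> min (p_bar_l \<mu> q s) (p_hat_l \<mu> q s)"
  shows "0 < pl" "pl < \<mu>" "\<And>p. 0 < p \<Longrightarrow> p < \<mu> \<Longrightarrow> p \<noteq> pl \<Longrightarrow> low_value p < low_value pl"
proof -
  note bar = p_bar_l_props and hat = p_hat_l_props
  show pl: "0 < pl" "pl < \<mu>" using bar hat by (auto simp: pl_def)
  have "crossing pl \<le> 0" using bar(4)[of pl] pl by (simp add: pl_def)
  then have val: "low_value pl = pl / \<alpha> pl" using crossing_sign(1)[OF pl] by (simp add: low_value_def)
  fix p assume p: "0 < p" "p < \<mu>" "p \<noteq> pl"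
  have st: "stationarity pl \<le> 0" using hat(3)[of pl] pl by (simp add: pl_def)
  show "low_value p < low_value pl"
  proof (cases "p < pl")
    case True
    then have "p / \<alpha> p < pl / \<alpha> pl" using scaled_ratio_less[of pl p] pl p st by auto
    then show ?thesis by (simp add: val) (simp add: low_value_def)
  next
    case False
    show ?thesis
    proof (cases "p_hat_l \<mu> q s \<le> p_bar_l \<mu> q s")
      case True
      then have "stationarity pl \<ge> 0" using hat(4)[of pl] pl by (simp add: pl_def)
      then have "p / \<alpha> p < pl / \<alpha> pl" using scaled_ratio_less[of pl p] pl p False by auto
      then show ?thesis by (simp add: val) (simp add: low_value_def)
    next
      case nle: False
      then have "crossing pl = 0" using bar(3) by (simp add: pl_def)
      then have "\<alpha> pl * (\<mu> - pl) = pl * (\<alpha> pl - pl)" by (simp add: crossing_def algebra_simps)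
      then have "pl / \<alpha> pl = top_weight pl"
        using alpha_gt_mu[OF pl] pl mu_pos by (simp add: top_weight_def field_simps)
      moreover have "top_weight p < top_weight pl"
        using top_weight_strict_antimono[of pl p] pl p False by auto
      ultimately show ?thesis by (simp add: val) (simp add: low_value_def)
    qed
  qed
qed

section \<open>Revenue guarantee of the three-point laws\<close>

text \<open>For the law on \<open>{0, p, \<beta>}\<close> with the given moments, the weight at \<open>\<beta>\<close> is proportional to
\<open>p * slack p\<close> and the weight at \<open>p\<close> to \<open>surplus\<close>, with the same factor. So \<open>share\<close> below is the
revenue at a price just above the atom \<open>p\<close> relative to the revenue at \<open>p\<close> itself. The point
\<open>\<tau>\<close> is the zero of \<open>slack\<close>: there the atom at \<open>\<beta>\<close> disappears.\<close>

definition slack :: "real \<Rightarrow> real"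
  where "slack p = s - \<mu> * p powr (q - 1)"

definition surplus :: real
  where "surplus = \<mu> * \<beta> powr q - s * \<beta>"

definition share :: "real \<Rightarrow> real"
  where "share p = p * slack p / (surplus + p * slack p)"

definition high_value :: "real \<Rightarrow> real"
  where "high_value p = min (p / \<beta>) (share p)"

text \<open>The sign of \<open>p / \<beta> - share p\<close> with denominators cleared; its zeros are the solutions of the
equation for \<open>p_bar_h\<close>.\<close>

definition high_crossing :: "real \<Rightarrow> real"
  where "high_crossing p = surplus + p * slack p - \<beta> * slack p"

lemma beta_pos: "\<beta> > 0" using mu_pos mu_less_beta by simp

lemma surplus_pos: "surplus > 0"
proof -
  have "\<tau> powr (q - 1) < \<beta> powr (q - 1)"
    using tau_pos tau2_less_beta q_gt_1 by (intro powr_less_mono2) auto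
  then have "s < \<mu> * \<beta> powr (q - 1)" using mu_pos by (simp add: tau_powr field_simps)
  then have "s * \<beta> < \<mu> * \<beta> powr (q - 1) * \<beta>" using beta_pos by simp
  then show ?thesis using powr_split[of \<beta>] beta_pos by (simp add: surplus_def mult.commute mult.left_commute)
qed

lemma slack_tau: "slack \<tau> = 0"
  using mu_pos by (simp add: slack_def tau_powr)

lemma slack_pos: "slack p > 0" if "0 \<le> p" "p < \<tau>"
proof -
  have "p powr (q - 1) < \<tau> powr (q - 1)"
    using that q_gt_1 by (intro powr_less_mono2) auto
  then show ?thesis using mu_pos by (simp add: slack_def tau_powr field_simps)
qed

lemma slack_nonneg: "slack p \<ge> 0" if "0 \<le> p" "p \<le> \<tau>"
  using slack_pos[of p] slack_tau that by (cases "p = \<tau>") auto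

lemma share_mono_iff:
  assumes "x * slack x \<ge> 0" "y * slack y \<ge> 0"
  shows "share x < share y \<longleftrightarrow> x * slack x < y * slack y"
proof -
  have "surplus + x * slack x > 0" "surplus + y * slack y > 0" using surplus_pos assms by auto
  then have "share x < share y \<longleftrightarrow>
      x * slack x * (surplus + y * slack y) < y * slack y * (surplus + x * slack x)"
    unfolding share_def by (simp add: divide_less_eq less_divide_eq mult.commute)
  also have "\<dots> \<longleftrightarrow> surplus * (x * slack x) < surplus * (y * slack y)"
    by (simp add: algebra_simps)
  finally show ?thesis using surplus_pos by simp
qed

lemma share_pos: "share p > 0" if "0 < p" "p < \<tau>"
  using slack_pos[of p] that surplus_pos by (simp add: share_def add_pos_pos)

lemma share_ratio_iff:
  assumes "0 < p" "p < \<tau>"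
  shows "p / \<beta> \<le> share p \<longleftrightarrow> high_crossing p \<le> 0"
    and "share p \<le> p / \<beta> \<longleftrightarrow> high_crossing p \<ge> 0"
proof -
  have pos: "surplus + p * slack p > 0"
    using surplus_pos slack_pos[of p] assms by (simp add: add_pos_pos)
  have "p / \<beta> \<le> share p \<longleftrightarrow> p * (surplus + p * slack p) \<le> p * (\<beta> * slack p)"
    using beta_pos pos unfolding share_def
    by (simp add: divide_le_eq le_divide_eq mult.commute mult.left_commute)
  then show "p / \<beta> \<le> share p \<longleftrightarrow> high_crossing p \<le> 0"
    using assms by (simp add: high_crossing_def)
  have "share p \<le> p / \<beta> \<longleftrightarrow> p * (\<beta> * slack p) \<le> p * (surplus + p * slack p)"
    using beta_pos pos unfolding share_def
    by (simp add: divide_le_eq le_divide_eq mult.commute mult.left_commute)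
  then show "share p \<le> p / \<beta> \<longleftrightarrow> high_crossing p \<ge> 0"
    using assms by (simp add: high_crossing_def)
qed

lemma p_bar_h_eq_iff: "p_bar_h_eq \<mu> q \<beta> s p \<longleftrightarrow> 0 < p \<and> p \<le> \<tau> \<and> high_crossing p = 0"
proof (cases "0 < p \<and> p \<le> \<tau>")
  case True
  then have "2 * \<beta> - p \<noteq> 0" using tau2_less_beta beta_pos by simp
  then have "(\<beta> powr q - p powr q + \<beta> * p powr (q - 1)) / (2 * \<beta> - p) = s / \<mu> \<longleftrightarrow>
      \<mu> * (\<beta> powr q - p powr q + \<beta> * p powr (q - 1)) = s * (2 * \<beta> - p)"
    using mu_pos by (simp add: frac_eq_eq mult.commute)
  also have "\<dots> \<longleftrightarrow> high_crossing p = 0"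
    using True powr_split[of p] by (auto simp: high_crossing_def surplus_def slack_def algebra_simps)
  finally show ?thesis using True by (simp add: p_bar_h_eq_def)
qed (auto simp: p_bar_h_eq_def)

lemma high_crossing_tau: "high_crossing \<tau> > 0"
  using surplus_pos by (simp add: high_crossing_def slack_tau)

lemma continuous_high_crossing: "continuous_on {c..\<tau>} high_crossing" if "0 < c"
  unfolding high_crossing_def slack_def using that by (auto intro!: continuous_intros)

lemma high_crossing_zero_above:
  assumes "0 < p" "p \<le> \<tau>" "high_crossing p \<le> 0"
  shows "\<exists>x\<ge>p. p_bar_h_eq \<mu> q \<beta> s x"
  using IVT'[of high_crossing p 0 \<tau>] continuous_high_crossing[of p] assms high_crossing_tau
  by (force simp: p_bar_h_eq_iff)

text \<open>The solutions not smaller than a given one form a compact set, so a greatest solution exists; beyond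
it the sign of \<open>high_crossing\<close> is the one at \<open>\<tau>\<close>.\<close>

lemma p_bar_h_props:
  assumes "p_bar_h_eq \<mu> q \<beta> s x"
  shows "p_bar_h_eq \<mu> q \<beta> s (p_bar_h \<mu> q \<beta> s)"
    and "\<And>p. p_bar_h \<mu> q \<beta> s < p \<Longrightarrow> p \<le> \<tau> \<Longrightarrow> high_crossing p > 0"
proof -
  have x: "0 < x" "x \<le> \<tau>" "high_crossing x = 0" using assms by (auto simp: p_bar_h_eq_iff)
  define Z where "Z = {p \<in> {x..\<tau>}. high_crossing p = 0}"
  have "closed Z"
    unfolding Z_def using continuous_high_crossing[OF x(1)]
    by (intro continuous_closed_preimage_constant) auto
  then have "compact Z"
    by (metis (no_types, lifting) Z_def bounded_closed_interval bounded_subset compact_eq_bounded_closed mem_Collect_eq subsetI)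
  moreover have "Z \<noteq> {}" using x by (auto simp: Z_def)
  ultimately obtain z where z: "z \<in> Z" "\<And>y. y \<in> Z \<Longrightarrow> y \<le> z"
    using compact_attains_sup by metis
  have eq: "p_bar_h_eq \<mu> q \<beta> s z" using z(1) x by (auto simp: Z_def p_bar_h_eq_iff)
  have greatest: "y \<le> z" if "p_bar_h_eq \<mu> q \<beta> s y" for y
    using z(2)[of y] z(1) that by (cases "x \<le> y") (auto simp: Z_def p_bar_h_eq_iff)
  have bar: "p_bar_h \<mu> q \<beta> s = z"
    unfolding p_bar_h_def by (rule Greatest_equality) (use eq greatest in auto)
  then show "p_bar_h_eq \<mu> q \<beta> s (p_bar_h \<mu> q \<beta> s)" using eq by simp
  fix p assume p: "p_bar_h \<mu> q \<beta> s < p" "p \<le> \<tau>"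
  show "high_crossing p > 0"
  proof (rule ccontr)
    assume "\<not> high_crossing p > 0"
    moreover have "0 < p" using p eq bar by (simp add: p_bar_h_eq_iff)
    ultimately obtain y where "y \<ge> p" "p_bar_h_eq \<mu> q \<beta> s y"
      using high_crossing_zero_above[of p] p by force
    then show False using greatest[of y] p bar by simp
  qed
qed

lemma p_hat_h_powr: "q * \<mu> * p_hat_h \<mu> q s powr (q - 1) = s"
  using q_gt_1 mu_pos s_pos by (simp add: p_hat_h_def powr_powr)

lemma p_hat_h_bounds: "0 < p_hat_h \<mu> q s" "p_hat_h \<mu> q s < \<tau>"
proof -
  show pos: "0 < p_hat_h \<mu> q s" using q_gt_1 mu_pos s_pos by (simp add: p_hat_h_def)
  have "s / (q * \<mu>) < s / \<mu>" using q_gt_1 mu_pos s_pos by (simp add: divide_strict_left_mono)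
  then show "p_hat_h \<mu> q s < \<tau>"
    unfolding p_hat_h_def tau2_def using q_gt_1 mu_pos s_pos by (intro powr_less_mono2) auto
qed

text \<open>The function \<open>p * slack p = s p - \<mu> p\<^sup>q\<close> is strictly concave with stationary point \<open>p_hat_h\<close>. The
tangent at \<open>y\<close> shows that it lies below its value at \<open>y\<close> on both sides when \<open>y\<close> is the stationary
point, and to the right of \<open>y\<close> when \<open>y\<close> is beyond it.\<close>

lemma slack_revenue_decreasing:
  assumes "0 \<le> p" "0 < y" "p \<noteq> y" "y \<le> p \<and> p_hat_h \<mu> q s \<le> y \<or> y = p_hat_h \<mu> q s"
  shows "p * slack p < y * slack y"
proof -
  have "y powr q + q * y powr (q - 1) * (p - y) < p powr q"
    using powr_above_tangent q_gt_1 assms by auto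
  then have "\<mu> * (y powr q + q * y powr (q - 1) * (p - y)) < \<mu> * p powr q"
    using mu_pos by simp
  moreover have "s * (p - y) \<le> q * \<mu> * y powr (q - 1) * (p - y)"
  proof (cases "y = p_hat_h \<mu> q s")
    case False
    then have "p_hat_h \<mu> q s powr (q - 1) \<le> y powr (q - 1)"
      using assms q_gt_1 p_hat_h_bounds by (intro powr_mono2) auto
    then have "q * \<mu> * p_hat_h \<mu> q s powr (q - 1) \<le> q * \<mu> * y powr (q - 1)"
      using q_gt_1 mu_pos by simp
    then show ?thesis using False assms by (simp add: p_hat_h_powr mult_right_mono)
  qed (simp add: p_hat_h_powr)
  ultimately show ?thesis
    using powr_split[of p] powr_split[of y] assms by (simp add: slack_def algebra_simps)
qed

text \<open>If \<open>ph\<close> is \<open>p_hat_h\<close>, no crossing lies to its right, so \<open>share\<close> is the smaller term at \<open>ph\<close>, and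
\<open>ph\<close> is its peak. Otherwise both terms agree at \<open>ph\<close>; smaller prices are bounded by the increasing
\<open>p / \<beta>\<close> and larger ones by \<open>share\<close>, which decreases beyond its peak.\<close>

lemma high_price_maximizes:
  defines "ph \<equiv> high_price \<mu> q \<beta> s"
  shows "0 < ph" "ph < \<tau>" "\<And>p. 0 < p \<Longrightarrow> p < \<tau> \<Longrightarrow> p \<noteq> ph \<Longrightarrow> high_value p < high_value ph"
proof -
  let ?hat = "p_hat_h \<mu> q s" and ?bar = "p_bar_h \<mu> q \<beta> s"
  note hat = p_hat_h_bounds
  have bar: "0 < ?bar" "?bar < \<tau>" "high_crossing ?bar = 0" if "p_bar_h_eq \<mu> q \<beta> s x" for x
    using p_bar_h_props(1)[OF that] high_crossing_tau
    by (auto simp: p_bar_h_eq_iff order_less_le)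
  show ph: "0 < ph" "ph < \<tau>" using hat bar by (auto simp: ph_def high_price_def)
  have above: "high_crossing p > 0" if "ph < p" "p < \<tau>" for p
  proof (cases "\<exists>x. p_bar_h_eq \<mu> q \<beta> s x")
    case True
    then show ?thesis using p_bar_h_props(2) that by (auto simp: ph_def high_price_def)
  next
    case False
    then show ?thesis using high_crossing_zero_above[of p] that ph by force
  qed
  have decr: "share p < share y" if "0 < p" "p < \<tau>" "0 < y" "y < \<tau>" "p \<noteq> y"
    "y \<le> p \<and> ?hat \<le> y \<or> y = ?hat" for p y
    using share_mono_iff[of p y] slack_revenue_decreasing[of p y] slack_pos[of p] slack_pos[of y] that
    by auto
  have hat_le: "?hat \<le> ph" by (simp add: ph_def high_price_def)
  fix p assume p: "0 < p" "p < \<tau>" "p \<noteq> ph"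
  show "high_value p < high_value ph"
  proof (cases "ph = ?hat")
    case True
    have nn: "high_crossing ph \<ge> 0"
    proof (cases "\<exists>x. p_bar_h_eq \<mu> q \<beta> s x")
      case ex: True
      then obtain x where x: "p_bar_h_eq \<mu> q \<beta> s x" ..
      have "?bar \<le> ph" using ex by (simp add: ph_def high_price_def)
      then show ?thesis using p_bar_h_props(2)[OF x, of ph] bar(3)[OF x] ph by (cases "?bar = ph") auto
    next
      case False
      then show ?thesis using high_crossing_zero_above[of ph] ph by force
    qed
    then have "share ph \<le> ph / \<beta>" using share_ratio_iff(2)[OF ph] by simp
    then have "high_value ph = share ph" by (simp add: high_value_def)
    moreover have "share p < share ph" using decr[of p ph] p ph True by auto
    ultimately show ?thesis by (simp add: high_value_def)
  next
    case False
    then have ex: "\<exists>x. p_bar_h_eq \<mu> q \<beta> s x" by (auto simp: ph_def high_price_def split: if_splits)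
    then have phb: "ph = ?bar" using False by (auto simp: ph_def high_price_def max_def split: if_splits)
    then have cr: "high_crossing ph = 0" using bar(3) ex by auto
    then have sh: "share ph = ph / \<beta>" using share_ratio_iff[OF ph] by (simp add: order_antisym)
    show ?thesis
    proof (cases "p < ph")
      case True
      then have "p / \<beta> < ph / \<beta>" using beta_pos by (simp add: divide_strict_right_mono)
      then show ?thesis using sh by (simp add: high_value_def)
    next
      case False
      then have "share p < share ph" using decr[of p ph] p ph hat_le by auto
      then show ?thesis using sh by (simp add: high_value_def)
    qed
  qed
qed

end

section \<open>Competitive ratios and feasible laws\<close>

lemma CR_le:
  assumes "bdd_above ((\<lambda>t. t * measure M {t..}) ` {0<..})"
    and "0 < t" "0 < t * measure M {t..}" "0 < p" "p * measure M {p..} \<le> c * (t * measure M {t..})"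
  shows "CR p M \<le> c"
proof -
  let ?S = "SUP t\<in>{0<..}. t * measure M {t..}"
  have le: "t * measure M {t..} \<le> ?S" using assms by (intro cSUP_upper) auto
  have "0 \<le> p * measure M {p..}" using assms by simp
  then have "0 \<le> c * (t * measure M {t..})" using assms by linarith
  then have "c \<ge> 0" using assms(3) by (simp only: zero_le_mult_iff) linarith
  then have "c * (t * measure M {t..}) \<le> c * ?S" using le by (rule mult_left_mono[rotated])
  then have "p * measure M {p..} \<le> c * ?S" using assms by linarith
  moreover have "?S > 0" using le assms by linarith
  ultimately show ?thesis by (simp add: CR_def divide_le_eq)
qed

lemma CR_ge:
  assumes "0 < p" "0 < measure M {p..}" "0 < m"
    and le: "\<And>t. 0 < t \<Longrightarrow> m * (t * measure M {t..}) \<le> p * measure M {p..}"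
  shows "m \<le> CR p M"
proof -
  let ?S = "SUP t\<in>{0<..}. t * measure M {t..}"
  have le': "t * measure M {t..} \<le> p * measure M {p..} / m" if "0 < t" for t
    using le[OF that] \<open>0 < m\<close> by (simp add: field_simps)
  have "?S \<le> p * measure M {p..} / m"
    using le' by (intro cSUP_least) auto
  moreover have "bdd_above ((\<lambda>t. t * measure M {t..}) ` {0<..})"
    using le' by (intro bdd_aboveI2) auto
  then have "p * measure M {p..} \<le> ?S" using assms by (intro cSUP_upper) auto
  then have "?S > 0" using assms by (smt (verit) mult_pos_pos)
  ultimately show ?thesis using \<open>0 < m\<close> by (simp add: CR_def field_simps)
qed

context pricing_problem
begin

abbreviation \<P> :: "real measure set" where "\<P> \<equiv> ambiguity_set \<mu> q \<beta> s"

abbreviation worst_case :: "real \<Rightarrow> real" where "worst_case \<equiv> worst_case_CR \<mu> q \<beta> s"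

lemma feasible_revenue_bounded:
  assumes "M \<in> \<P>" "0 < t"
  shows "t * measure M {t..} \<le> \<beta>" and "\<beta> < t \<Longrightarrow> measure M {t..} = 0"
proof -
  interpret real_distribution M using assms by (simp add: ambiguity_set_def)
  have one: "prob {0..\<beta>} = 1" using assms by (simp add: ambiguity_set_def)
  show zero: "measure M {t..} = 0" if "\<beta> < t"
  proof -
    have "prob ({t..} \<union> {0..\<beta>}) = prob {t..} + prob {0..\<beta>}"
      using that by (intro finite_measure_Union) auto
    then show ?thesis using one prob_le_1[of "{t..} \<union> {0..\<beta>}"] measure_nonneg[of M "{t..}"] by linarith
  qed
  have "t * measure M {t..} \<le> t * 1" using assms by (intro mult_left_mono) auto
  then show "t * measure M {t..} \<le> \<beta>" using zero beta_pos by (cases "t \<le> \<beta>") auto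
qed

lemma bdd_above_revenue: "bdd_above ((\<lambda>t. t * measure M {t..}) ` {0<..})" if "M \<in> \<P>"
  using feasible_revenue_bounded[OF that] by (intro bdd_aboveI2) auto

text \<open>Weak duality for the moment problem. Any combination of \<open>1, x, x\<^sup>q\<close> with the pointwise property is
a certificate, and each lower bound on the worst case below exhibits one.\<close>

lemma moment_inequality:
  assumes "M \<in> \<P>"
    and le: "\<And>x. 0 \<le> x \<Longrightarrow> x \<le> \<beta> \<Longrightarrow>
      c * indicator {t..} x \<le> a0 + a1 * x + a2 * x powr q + d * indicator {p..} x"
  shows "c * measure M {t..} \<le> a0 + a1 * \<mu> + a2 * s + d * measure M {p..}"
proof -
  interpret real_distribution M using assms by (simp add: ambiguity_set_def)
  have M: "prob {0..\<beta>} = 1" "(\<integral>x. x \<partial>M) = \<mu>" "(\<integral>x. x powr q \<partial>M) = s"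
    using assms by (auto simp: ambiguity_set_def)
  have ae: "AE x in M. 0 \<le> x \<and> x \<le> \<beta>" using AE_prob_1[OF M(1)] by simp
  have i1: "integrable M (\<lambda>x. x)"
    using ae beta_pos by (intro integrable_const_bound[of _ \<beta>]) auto
  have "AE x in M. norm (x powr q) \<le> \<beta> powr q"
    using ae by eventually_elim (use q_gt_1 in \<open>auto intro: powr_mono2\<close>)
  then have i2: "integrable M (\<lambda>x. x powr q)" by (rule integrable_const_bound) simp
  have "c * measure M {t..} = (\<integral>x. c * indicator {t..} x \<partial>M)" by simp
  also have "\<dots> \<le> (\<integral>x. a0 + a1 * x + a2 * x powr q + d * indicator {p..} x \<partial>M)"
    using i1 i2 ae le by (intro integral_mono_AE) (auto simp: emeasure_eq_measure)
  also have "\<dots> = a0 + a1 * \<mu> + a2 * s + d * measure M {p..}"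
    using i1 i2 prob_space by (simp add: M emeasure_eq_measure)
  finally show ?thesis .
qed

lemma three_point_feasible:
  assumes "u \<ge> 0" "v \<ge> 0" "w \<ge> 0" "u + v + w = 1" "0 \<le> x" "0 \<le> y" "0 \<le> z" "x \<le> \<beta>" "y \<le> \<beta>" "z \<le> \<beta>"
    and "u * x + v * y + w * z = \<mu>" "u * x powr q + v * y powr q + w * z powr q = s"
  obtains M where "M \<in> \<P>"
    "\<And>t. measure M {t..} = (if t \<le> x then u else 0) + (if t \<le> y then v else 0) + (if t \<le> z then w else 0)"
proof -
  obtain M :: "real measure" where M: "real_distribution M"
    "\<And>h :: real \<Rightarrow> real. h \<in> borel_measurable borel \<Longrightarrow> (\<integral>r. h r \<partial>M) = u * h x + v * h y + w * h z"
    "\<And>A. A \<in> sets borel \<Longrightarrow> measure M A = u * indicator A x + v * indicator A y + w * indicator A z"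
    using three_point_law[OF assms(1-4)] by blast
  have "M \<in> \<P>"
    using M(1) M(2)[of "\<lambda>r. r"] M(2)[of "\<lambda>r. r powr q"] M(3)[of "{0..\<beta>}"] assms
    by (simp add: ambiguity_set_def)
  moreover have "measure M {t..} = (if t \<le> x then u else 0) + (if t \<le> y then v else 0) + (if t \<le> z then w else 0)" for t
    using M(3)[of "{t..}"] by (auto simp: indicator_def)
  ultimately show thesis using that by blast
qed

lemma worst_case_le:
  assumes "M \<in> \<P>" "0 < t" "0 < measure M {t..}" "0 < p"
    "p * measure M {p..} \<le> c * (t * measure M {t..})"
  shows "worst_case p \<le> c"
proof -
  have "CR x M' \<ge> 0" if "0 < x" "M' \<in> \<P>" for x M'
  proof -
    have "0 \<le> x * measure M' {x..}" using that by simp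
    also have "\<dots> \<le> (SUP t\<in>{0<..}. t * measure M' {t..})"
      using that bdd_above_revenue by (intro cSUP_upper) auto
    finally show ?thesis using that by (simp add: CR_def)
  qed
  then have "worst_case p \<le> CR p M"
    using assms unfolding worst_case_CR_def by (intro cINF_lower) (auto intro!: bdd_belowI2[of _ 0])
  also have "\<dots> \<le> c" using assms bdd_above_revenue by (intro CR_le) auto
  finally show ?thesis .
qed

text \<open>The law on \<open>{0, p, \<beta>}\<close>. The moments determine the weights at \<open>p\<close> and \<open>\<beta>\<close>; the weight
left for \<open>0\<close> is nonnegative precisely if \<open>excess p \<beta> \<le> 0\<close>, and the one at \<open>\<beta>\<close> if
\<open>p \<le> \<tau>\<close>.\<close>

lemma extremal_three_point_law:
  assumes "0 < p" "p \<le> \<tau>" "excess p \<beta> \<le> 0"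
  obtains M where "M \<in> \<P>"
    "\<And>t. p < t \<Longrightarrow> t \<le> \<beta> \<Longrightarrow> measure M {t..} = slack p / (\<beta> * (\<beta> powr (q - 1) - p powr (q - 1)))"
    "measure M {p..} = (surplus + p * slack p) / (p * \<beta> * (\<beta> powr (q - 1) - p powr (q - 1)))"
    "0 < p * \<beta> * (\<beta> powr (q - 1) - p powr (q - 1))"
proof -
  define b c where "b = \<beta> powr (q - 1)" and "c = p powr (q - 1)"
  have pb: "p < \<beta>" using assms tau2_less_beta by simp
  have bc: "b - c > 0" using pb assms q_gt_1 unfolding b_def c_def by (simp add: powr_less_mono2)
  have powers: "\<beta> powr q = \<beta> * b" "p powr q = p * c"
    using powr_split[of \<beta>] powr_split[of p] beta_pos assms by (auto simp: b_def c_def)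
  have sl: "slack p = s - \<mu> * c" "surplus = \<beta> * (\<mu> * b - s)"
    using powers by (auto simp: slack_def surplus_def c_def algebra_simps)
  define v w where "v = (\<mu> * b - s) / (p * (b - c))" and "w = slack p / (\<beta> * (b - c))"
  have "\<mu> * b - s > 0" using surplus_pos beta_pos sl by (simp add: zero_less_mult_iff)
  then have nn: "v \<ge> 0" "w \<ge> 0"
    using bc assms slack_nonneg[of p] beta_pos by (auto simp: v_def w_def)
  have vp: "v * p = (\<mu> * b - s) / (b - c)" and wb: "w * \<beta> = (s - \<mu> * c) / (b - c)"
    using assms beta_pos by (auto simp: v_def w_def sl(1))
  have vw: "v + w = (surplus + p * slack p) / (p * \<beta> * (b - c))"
  proof -
    have "v = surplus / (p * \<beta> * (b - c))" "w = p * slack p / (p * \<beta> * (b - c))"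
      using assms beta_pos by (auto simp: v_def w_def sl(2))
    then show ?thesis by (simp add: add_divide_distrib)
  qed
  have "surplus + p * slack p \<le> p * \<beta> * (b - c)"
    using assms(3) by (simp add: excess_def powers sl algebra_simps)
  then have "v + w \<le> 1" using vw assms beta_pos bc by simp
  moreover have "v * p + w * \<beta> = \<mu>"
  proof -
    have "v * p + w * \<beta> = (\<mu> * (b - c)) / (b - c)"
      unfolding vp wb by (simp add: add_divide_distrib[symmetric] algebra_simps)
    then show ?thesis using bc by simp
  qed
  moreover have "v * p powr q + w * \<beta> powr q = s"
  proof -
    have "v * p powr q + w * \<beta> powr q = (v * p) * c + (w * \<beta>) * b" by (simp add: powers)
    also have "\<dots> = (s * (b - c)) / (b - c)"
      unfolding vp wb by (simp add: add_divide_distrib[symmetric] algebra_simps)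
    finally show ?thesis using bc by simp
  qed
  ultimately obtain M where M: "M \<in> \<P>"
    "\<And>t. measure M {t..} = (if t \<le> 0 then 1 - (v + w) else 0) + (if t \<le> p then v else 0) + (if t \<le> \<beta> then w else 0)"
    using three_point_feasible[of "1 - (v + w)" v w 0 p \<beta>] nn assms pb beta_pos by auto
  show thesis
  proof (rule that[OF M(1)])
    show "measure M {t..} = slack p / (\<beta> * (\<beta> powr (q - 1) - p powr (q - 1)))" if "p < t" "t \<le> \<beta>" for t
      using M(2)[of t] that assms by (simp add: w_def b_def c_def)
    show "measure M {p..} = (surplus + p * slack p) / (p * \<beta> * (\<beta> powr (q - 1) - p powr (q - 1)))"
      using M(2)[of p] vw pb assms by (simp add: b_def c_def)
    show "0 < p * \<beta> * (\<beta> powr (q - 1) - p powr (q - 1))"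
      using bc assms beta_pos by (simp add: b_def c_def)
  qed
qed

lemma P_nonempty: "\<P> \<noteq> {}"
  using extremal_three_point_law[of \<tau>] excess_neg_above_mu[of \<tau> \<beta>] tau_pos mu_less_tau tau2_less_beta
  by fastforce

lemma worst_case_ge:
  assumes "\<And>M. M \<in> \<P> \<Longrightarrow> m \<le> CR p M"
  shows "m \<le> worst_case p"
  unfolding worst_case_CR_def using P_nonempty assms by (rule cINF_greatest)

section \<open>Lower bounds on the worst case by moment duality\<close>

text \<open>The dual function for the least mass above \<open>p\<close> is the concave \<open>1 - tangent_gap (\<alpha> p) x / g\<close>
with \<open>g = tangent_gap (\<alpha> p) p\<close>: it vanishes at \<open>p\<close>, is nonpositive before \<open>p\<close>, and touches \<open>1\<close>
at \<open>\<alpha>(p)\<close>. The proof uses it multiplied by \<open>g\<close>.\<close>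

lemma top_weight_le_prob:
  assumes "M \<in> \<P>" "0 < p" "p < \<mu>"
  shows "top_weight p \<le> measure M {p..}"
proof -
  let ?a = "\<alpha> p"
  define g where "g = tangent_gap ?a p"
  have a: "\<mu> < ?a" "0 < ?a" "p < ?a" using alpha_gt_mu[of p] assms mu_pos by auto
  have g: "g > 0" using tangent_gap_pos[of p ?a] a assms by (simp add: g_def)
  define k where "k = q * ?a powr (q - 1)"
  have "0 * measure M {p..} \<le> (k * ?a - ?a powr q - g) + (- k) * \<mu> + 1 * s + g * measure M {p..}"
  proof (rule moment_inequality[OF assms(1)])
    fix x assume x: "0 \<le> x" "x \<le> \<beta>"
    have "tangent_gap ?a x \<ge> 0" using tangent_gap_nonneg x a by simp
    moreover have "g \<le> tangent_gap ?a x" if "x < p"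
      using tangent_gap_antimono[of x p ?a] that x a assms by (simp add: g_def)
    ultimately show "0 * indicator {p..} x \<le> (k * ?a - ?a powr q - g) + (- k) * x + 1 * x powr q + g * indicator {p..} x"
      by (cases "x < p") (auto simp: tangent_gap_def k_def algebra_simps)
  qed
  moreover have "s - (?a powr q + k * (\<mu> - ?a)) = (1 - top_weight p) * g"
    using tangent_gap_mean[of p] assms by (simp add: k_def g_def)
  ultimately have "g * top_weight p \<le> g * measure M {p..}" by (simp add: algebra_simps)
  then show ?thesis using g by simp
qed

text \<open>The dual function is \<open>x\<^sup>q\<close> minus its chord over \<open>[p, \<alpha>(p)]\<close>, which integrates to zero because the
chord passes through \<open>(\<mu>, s)\<close>. It is nonnegative below \<open>p\<close>, and everywhere at least
\<open>k (x - \<alpha>(p))\<close>, where \<open>k\<close> is the gap between the slopes of the tangent and of the chord at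
\<open>\<alpha>(p)\<close>. Adding \<open>k \<alpha>(p)\<close> above \<open>p\<close> thus dominates \<open>k x\<close> there.\<close>

lemma revenue_above_le:
  assumes "M \<in> \<P>" "0 < p" "p < \<mu>" "p \<le> t"
  shows "t * measure M {t..} \<le> \<alpha> p * measure M {p..}"
proof -
  let ?a = "\<alpha> p"
  note w = two_point_moments[OF assms(2,3)]
  have a: "\<mu> < ?a" "0 < ?a" "p < ?a" using alpha_gt_mu[of p] assms mu_pos by auto
  define D where "D = (?a powr q - p powr q) / (?a - p)"
  define k where "k = q * ?a powr (q - 1) - D"
  have D: "D * (?a - p) = ?a powr q - p powr q" using a by (simp add: D_def)
  have "0 < k * (?a - p)"
    using tangent_gap_pos[of p ?a] a assms D by (simp add: k_def tangent_gap_def algebra_simps)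
  then have k: "k > 0" using a by (simp add: zero_less_mult_iff)
  have L: "s = ?a powr q + D * (\<mu> - ?a)"
  proof -
    have "\<mu> - ?a = (1 - top_weight p) * (p - ?a)" using w(3) by (simp add: algebra_simps)
    then have "D * (\<mu> - ?a) = D * ((1 - top_weight p) * (p - ?a))" by simp
    then have "?a powr q + D * (\<mu> - ?a) = ?a powr q - (1 - top_weight p) * (D * (?a - p))"
      by (simp add: algebra_simps)
    also have "\<dots> = s" unfolding D using w(4) by (simp add: algebra_simps)
    finally show ?thesis by simp
  qed
  have "(k * t) * measure M {t..} \<le> (D * ?a - ?a powr q) + (- D) * \<mu> + 1 * s + (k * ?a) * measure M {p..}"
  proof (rule moment_inequality[OF assms(1)])
    fix x assume x: "0 \<le> x" "x \<le> \<beta>"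
    have chord: "x powr q - (?a powr q + D * (x - ?a)) \<ge> 0" if "x < p"
    proof -
      have "p powr q * (?a - x) < x powr q * (?a - p) + ?a powr q * (p - x)"
        using powr_below_chord q_gt_1 x that a by auto
      then have "0 < x powr q * (?a - p) - ?a powr q * (?a - p) + (?a powr q - p powr q) * (?a - x)"
        by (simp add: algebra_simps)
      also have "\<dots> = (x powr q - (?a powr q + D * (x - ?a))) * (?a - p)"
        unfolding D[symmetric] by (simp add: algebra_simps)
      finally show ?thesis using a by (simp add: zero_less_mult_iff)
    qed
    have tangent: "x powr q - (?a powr q + D * (x - ?a)) \<ge> k * (x - ?a)"
      using tangent_gap_nonneg[of x ?a] x a by (simp add: tangent_gap_def k_def algebra_simps)
    define e where "e = x powr q - (?a powr q + D * (x - ?a))"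
    have "(k * t) * indicator {t..} x \<le> e + (k * ?a) * indicator {p..} x"
    proof (cases "x < p")
      case True
      then show ?thesis using chord assms(4) by (simp add: e_def)
    next
      case False
      have "(k * t) * indicator {t..} x \<le> k * x" using k x by (simp add: indicator_def)
      also have "\<dots> \<le> e + k * ?a" using tangent by (simp add: e_def right_diff_distrib)
      finally show ?thesis using False by simp
    qed
    then show "(k * t) * indicator {t..} x
        \<le> (D * ?a - ?a powr q) + (- D) * x + 1 * x powr q + (k * ?a) * indicator {p..} x"
      by (simp add: e_def algebra_simps)
  qed
  also have "\<dots> = (k * ?a) * measure M {p..}"
    using L right_diff_distrib[of D \<mu> ?a] by linarith
  finally show ?thesis using k by simp
qed

text \<open>Against prices up to \<open>p\<close> the benchmark revenue is at most \<open>p\<close>, and the mass bound gives the ratio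
\<open>w(p)\<close>; against prices above \<open>p\<close> the previous lemma gives the ratio \<open>p / \<alpha>(p)\<close>.\<close>

lemma low_value_le_worst_case:
  assumes "0 < p" "p < \<mu>"
  shows "low_value p \<le> worst_case p"
proof (rule worst_case_ge)
  fix M assume M: "M \<in> \<P>"
  then interpret real_distribution M by (simp add: ambiguity_set_def)
  note w = two_point_moments[OF assms]
  have a: "0 < \<alpha> p" using alpha_gt_mu[OF assms] mu_pos by simp
  have tw: "top_weight p \<le> measure M {p..}" using top_weight_le_prob M assms .
  show "low_value p \<le> CR p M"
  proof (rule CR_ge)
    show "0 < measure M {p..}" using tw w by linarith
    show pos: "0 < low_value p" using a w assms by (simp add: low_value_def)
    fix t :: real assume t: "0 < t"
    show "low_value p * (t * measure M {t..}) \<le> p * measure M {p..}"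
    proof (cases "t \<le> p")
      case True
      have "t * measure M {t..} \<le> p * 1" using True t by (intro mult_mono) auto
      then have "low_value p * (t * measure M {t..}) \<le> low_value p * p"
        using pos by (simp only: mult_1_right mult_left_mono)
      also have "\<dots> \<le> measure M {p..} * p" using tw assms by (intro mult_right_mono) (auto simp: low_value_def)
      finally show ?thesis by (simp add: mult.commute)
    next
      case False
      have "low_value p * (t * measure M {t..}) \<le> (p / \<alpha> p) * (\<alpha> p * measure M {p..})"
        using revenue_above_le[OF M assms, of t] False pos t a assms
        by (intro mult_mono[of "low_value p" _ "t * measure M {t..}"]) (auto simp: low_value_def)
      then show ?thesis using a by simp
    qed
  qed (use assms in simp)
qed

text \<open>Against prices \<open>t \<le> p\<close> the dual function is \<open>s x - \<mu> x\<^sup>q = x * slack x\<close>, which integrates to zero: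
on \<open>[0, \<beta>]\<close> it dominates \<open>slack p * x\<close>
before \<open>p\<close> and is smallest at \<open>\<beta>\<close>, with value \<open>- surplus\<close>. Against prices \<open>t > p\<close> the trivial
bounds \<open>t \<le> \<beta>\<close> and monotonicity of the tail suffice.\<close>

lemma high_value_le_worst_case:
  assumes "0 < p" "p < \<tau>"
  shows "high_value p \<le> worst_case p"
proof (rule worst_case_ge)
  fix M assume M: "M \<in> \<P>"
  then interpret real_distribution M by (simp add: ambiguity_set_def)
  have sl: "slack p > 0" using slack_pos[of p] assms by simp
  have A: "surplus + p * slack p > 0" using surplus_pos sl assms by (simp add: add_pos_pos)
  have low: "(slack p * t) * measure M {t..} \<le> (surplus + p * slack p) * measure M {p..}"
    if "0 < t" "t \<le> p" for t
  proof -
    have "(slack p * t) * measure M {t..} \<le> 0 + s * \<mu> + (- \<mu>) * s + (surplus + p * slack p) * measure M {p..}"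
    proof (rule moment_inequality[OF M])
      fix x assume x: "0 \<le> x" "x \<le> \<beta>"
      have rw: "s * x - \<mu> * x powr q = x * slack x" "surplus = - (\<beta> * slack \<beta>)"
        using powr_split x beta_pos by (auto simp: slack_def surplus_def algebra_simps)
      have anti: "slack y \<le> slack z" if "0 \<le> z" "z \<le> y" for y z
        using that q_gt_1 mu_pos by (simp add: slack_def powr_mono2)
      have small: "slack p * x \<le> x * slack x" if "x < p"
        using anti[of x p] that x by (simp add: mult.commute mult_left_mono)
      have large: "- surplus \<le> x * slack x"
      proof (cases "slack x \<ge> 0")
        case True
        then show ?thesis using surplus_pos x by (smt (verit) mult_nonneg_nonneg)
      next
        case False
        then have "\<beta> * slack x \<le> x * slack x" using x by (simp add: mult_right_mono_neg)
        moreover have "\<beta> * slack \<beta> \<le> \<beta> * slack x" using anti x beta_pos by simp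
        ultimately show ?thesis by (simp add: rw(2))
      qed
      have "(slack p * t) * indicator {t..} x \<le> x * slack x + (surplus + p * slack p) * indicator {p..} x"
      proof (cases "x < p")
        case True
        have "(slack p * t) * indicator {t..} x \<le> slack p * x" using sl x by (simp add: indicator_def)
        then show ?thesis using small[OF True] True by simp
      next
        case False
        have "slack p * t \<le> p * slack p" using that sl by (simp add: mult.commute)
        then show ?thesis using False that large by simp
      qed
      then show "(slack p * t) * indicator {t..} x
          \<le> 0 + s * x + (- \<mu>) * x powr q + (surplus + p * slack p) * indicator {p..} x"
        using rw(1) by simp
    qed
    then show ?thesis by simp
  qed
  \<comment> \<open>If all mass lay below \<open>p\<close>, then \<open>x\<^sup>q \<le> p\<^sup>q\<^sup>-\<^sup>1 x\<close> would force \<open>slack p \<le> 0\<close>.\<close>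
  have pos: "0 < measure M {p..}"
  proof -
    have "0 * measure M {p..} \<le> 0 + p powr (q - 1) * \<mu> + (-1) * s + \<beta> powr q * measure M {p..}"
    proof (rule moment_inequality[OF M])
      fix x assume x: "0 \<le> x" "x \<le> \<beta>"
      have "x powr q \<le> \<beta> powr q" using x q_gt_1 by (intro powr_mono2) auto
      moreover have "x powr q \<le> p powr (q - 1) * x" if "x < p"
        using powr_split[of x] powr_mono2[of "q - 1" x p] that x q_gt_1
        by (simp add: mult.commute mult_left_mono)
      moreover have "p powr (q - 1) * x \<ge> 0" using x by simp
      ultimately show "0 * indicator {p..} x \<le> 0 + p powr (q - 1) * x + (-1) * x powr q + \<beta> powr q * indicator {p..} x"
        by (cases "x < p") auto
    qed
    then have "slack p \<le> \<beta> powr q * measure M {p..}" by (simp add: slack_def mult.commute)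
    then have "0 < \<beta> powr q * measure M {p..}" using sl by linarith
    then show ?thesis by (simp add: zero_less_mult_iff)
  qed
  show "high_value p \<le> CR p M"
  proof (rule CR_ge)
    show hv: "0 < high_value p" using share_pos[of p] assms beta_pos by (simp add: high_value_def)
    fix t :: real assume t: "0 < t"
    show "high_value p * (t * measure M {t..}) \<le> p * measure M {p..}"
    proof (cases "t \<le> p")
      case True
      have "high_value p * (t * measure M {t..}) \<le> share p * (t * measure M {t..})"
        using t by (intro mult_right_mono) (auto simp: high_value_def)
      also have "\<dots> = p * ((slack p * t) * measure M {t..}) / (surplus + p * slack p)"
        by (simp add: share_def)
      also have "\<dots> \<le> p * ((surplus + p * slack p) * measure M {p..}) / (surplus + p * slack p)"
        using low[OF t True] A assms by (intro divide_right_mono mult_left_mono) auto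
      also have "\<dots> = p * measure M {p..}" using A by simp
      finally show ?thesis .
    next
      case False
      show ?thesis
      proof (cases "t \<le> \<beta>")
        case True
        have "measure M {t..} \<le> measure M {p..}" using False by (intro finite_measure_mono) auto
        then have "high_value p * (t * measure M {t..}) \<le> (p / \<beta>) * (\<beta> * measure M {p..})"
          using hv t True by (intro mult_mono) (auto simp: high_value_def)
        then show ?thesis using beta_pos by simp
      next
        case False
        then show ?thesis using feasible_revenue_bounded(2)[OF M t] assms by simp
      qed
    qed
  qed (use assms pos in auto)
qed

section \<open>Upper bounds on the worst case from extremal laws\<close>

text \<open>Sales at the price \<open>p\<close> include an atom at \<open>p\<close>, so the adversary puts its lower atom at \<open>u < p\<close>, and the
bound is the limit \<open>u \<rightarrow> p\<close>. The two terms compare with the revenue at \<open>\<alpha>(u)\<close> and at \<open>u\<close>. Since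
\<open>\<alpha>\<close> is increasing, \<open>\<alpha>(p) \<le> \<beta>\<close> keeps these laws feasible.\<close>

lemma worst_case_le_low_value:
  assumes "0 < p" "p < \<mu>" "\<alpha> p \<le> \<beta>"
  shows "worst_case p \<le> low_value p"
proof -
  have a: "0 < \<alpha> p" using alpha_gt_mu[of p] assms mu_pos by simp
  have bounds: "worst_case p \<le> p / \<alpha> u \<and> worst_case p \<le> p * top_weight u / u" if "0 < u" "u < p" for u
  proof -
    have u: "0 < u" "u < \<mu>" using that assms by auto
    note w = two_point_moments[OF u]
    have a: "\<mu> < \<alpha> u" "\<alpha> u < \<alpha> p" using alpha_gt_mu[OF u] alpha_strict_mono[of u p] that assms by auto
    obtain M where M: "M \<in> \<P>" "\<And>t. measure M {t..} =
        (if t \<le> u then 0 else 0) + (if t \<le> u then 1 - top_weight u else 0) + (if t \<le> \<alpha> u then top_weight u else 0)"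
      using three_point_feasible[of 0 "1 - top_weight u" "top_weight u" u u "\<alpha> u"] w u a assms mu_pos
      by (auto simp: add.commute)
    have m: "measure M {p..} = top_weight u" "measure M {\<alpha> u..} = top_weight u" "measure M {u..} = 1"
      using M(2) a u assms that by auto
    have "worst_case p \<le> p / \<alpha> u" using m w a assms mu_pos by (intro worst_case_le[OF M(1), of "\<alpha> u"]) auto
    moreover have "worst_case p \<le> p * top_weight u / u"
      using m w a assms u by (intro worst_case_le[OF M(1), of u]) auto
    ultimately show ?thesis ..
  qed
  have ev: "eventually (\<lambda>u. 0 < u \<and> u < p) (at_left p)"
    using eventually_at_left_field assms(1) by blast
  have ca: "(\<alpha> \<longlongrightarrow> \<alpha> p) (at_left p)" and cw: "(top_weight \<longlongrightarrow> top_weight p) (at_left p)"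
    using isCont_alpha[of p] isCont_top_weight[of p] assms
    by (auto simp: isCont_def intro: filterlim_mono at_le)
  have "worst_case p \<le> p / \<alpha> p"
    using a by (intro tendsto_lowerbound[OF tendsto_divide[OF tendsto_const ca]]
        eventually_mono[OF ev]) (use bounds in auto)
  moreover have "((\<lambda>u. p * top_weight u / u) \<longlongrightarrow> p * top_weight p / p) (at_left p)"
    using assms cw by (intro tendsto_intros) auto
  then have "worst_case p \<le> p * top_weight p / p"
    by (rule tendsto_lowerbound) (use bounds in \<open>auto intro!: eventually_mono[OF ev]\<close>)
  ultimately show ?thesis using assms by (simp add: low_value_def)
qed

lemma worst_case_le_extremal:
  assumes "0 < u" "u < p" "u \<le> \<tau>" "excess u \<beta> \<le> 0"
  shows "worst_case p \<le> p * share u / u" and "u < \<tau> \<Longrightarrow> p \<le> \<beta> \<Longrightarrow> worst_case p \<le> p / \<beta>"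
proof -
  let ?d = "\<beta> powr (q - 1) - u powr (q - 1)"
  obtain M where M: "M \<in> \<P>" "\<And>t. u < t \<Longrightarrow> t \<le> \<beta> \<Longrightarrow> measure M {t..} = slack u / (\<beta> * ?d)"
    "measure M {u..} = (surplus + u * slack u) / (u * \<beta> * ?d)" "0 < u * \<beta> * ?d"
    using extremal_three_point_law[of u] assms by blast
  have "0 < u * \<beta>" using assms beta_pos by simp
  then have d: "?d > 0" using M(4) zero_less_mult_pos by blast
  have sl: "slack u \<ge> 0" using slack_nonneg[of u] assms by simp
  then have A: "surplus + u * slack u > 0" using surplus_pos assms by (simp add: add_pos_nonneg)
  have le: "measure M {p..} \<le> slack u / (\<beta> * ?d)"
    using M(2)[of p] feasible_revenue_bounded(2)[OF M(1), of p] assms sl d beta_pos by (cases "p \<le> \<beta>") auto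
  show "worst_case p \<le> p * share u / u"
  proof (rule worst_case_le[OF M(1), of u])
    show "0 < measure M {u..}" using M(3,4) A by simp
    have "p * share u / u * (u * measure M {u..}) = p * (slack u / (\<beta> * ?d))"
      using A M(4) assms d beta_pos unfolding M(3) share_def by simp
    moreover have "p * measure M {p..} \<le> p * (slack u / (\<beta> * ?d))"
      using le assms by (intro mult_left_mono) auto
    ultimately show "p * measure M {p..} \<le> p * share u / u * (u * measure M {u..})" by simp
  qed (use assms in auto)
  show "worst_case p \<le> p / \<beta>" if "u < \<tau>" "p \<le> \<beta>"
  proof (rule worst_case_le[OF M(1), of \<beta>])
    have "slack u > 0" using slack_pos[of u] that assms by simp
    then show "0 < measure M {\<beta>..}" using M(2)[of \<beta>] d beta_pos assms that by simp
    have "measure M {p..} \<le> measure M {\<beta>..}" using M(2)[of \<beta>] le that assms by simp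
    then show "p * measure M {p..} \<le> p / \<beta> * (\<beta> * measure M {\<beta>..})"
      using assms beta_pos by simp
  qed (use assms beta_pos in auto)
qed

text \<open>When \<open>\<alpha>(p) > \<beta>\<close> or \<open>p \<ge> \<mu>\<close>, \<open>excess p \<beta>\<close> is negative, and it stays so slightly to the left of
\<open>p\<close>; the three-point laws with lower positive atom \<open>u < p\<close> are feasible there.\<close>

lemma worst_case_le_high_value:
  assumes "0 < p" "p \<le> \<tau>" "p < \<mu> \<Longrightarrow> \<beta> < \<alpha> p"
  shows "worst_case p \<le> high_value p"
proof -
  have neg: "excess p \<beta> < 0"
    using excess_sign(1)[of p \<beta>] excess_neg_above_mu[of p \<beta>] assms mu_less_beta tau2_less_beta
    by (cases "p < \<mu>") auto
  have "((\<lambda>u. excess u \<beta>) \<longlongrightarrow> excess p \<beta>) (at_left p)"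
    unfolding excess_def using assms by (auto intro!: tendsto_eq_intros)
  then have ev1: "eventually (\<lambda>u. excess u \<beta> < 0) (at_left p)" using neg order_tendstoD(2) by blast
  have "eventually (\<lambda>u. 0 < u \<and> u < p) (at_left p)"
    using eventually_at_left_field assms(1) by blast
  with ev1 have ev: "eventually (\<lambda>u. worst_case p \<le> p * share u / u \<and> worst_case p \<le> p / \<beta>) (at_left p)"
    by eventually_elim (use worst_case_le_extremal[of _ p] assms tau2_less_beta in auto)
  have "surplus + p * slack p \<noteq> 0" using surplus_pos slack_nonneg[of p] assms by (smt (verit) mult_nonneg_nonneg)
  then have "((\<lambda>u. p * share u / u) \<longlongrightarrow> p * share p / p) (at_left p)"
    unfolding share_def slack_def using assms by (intro tendsto_intros) auto
  then have "worst_case p \<le> p * share p / p"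
    by (rule tendsto_lowerbound) (use ev in \<open>auto elim: eventually_mono\<close>)
  moreover have "worst_case p \<le> p / \<beta>"
    using eventually_happens'[OF _ ev] by auto
  ultimately show ?thesis using assms by (simp add: high_value_def)
qed

lemma worst_case_nonpos_above_tau: "worst_case p \<le> 0" if "\<tau> \<le> p"
proof (cases "p = \<tau>")
  case True
  then show ?thesis
    using worst_case_le_high_value[of \<tau>] tau_pos mu_less_tau by (simp add: high_value_def share_def slack_tau)
next
  case False
  then show ?thesis
    using worst_case_le_extremal(1)[of \<tau> p] that tau_pos excess_neg_above_mu[of \<tau> \<beta>] mu_less_tau tau2_less_beta
    by (simp add: share_def slack_tau)
qed

end

section \<open>Optimal robust prices\<close>

theorem theorem5p3:
  fixes \<mu> q \<beta> s :: real
  assumes "q > 1" and "0 < \<mu>" and "\<mu> < \<beta>"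
    and "s > \<mu> powr q" and "tau2 \<mu> q s < \<beta>"
  shows "optimal_robust_prices \<mu> q \<beta> s \<noteq> {} \<and>
    optimal_robust_prices \<mu> q \<beta> s \<subseteq>
      {min (p_bar_l \<mu> q s) (p_hat_l \<mu> q s), high_price \<mu> q \<beta> s}"
proof -
  interpret pricing_problem \<mu> q \<beta> s using assms by unfold_locales
  let ?pl = "min (p_bar_l \<mu> q s) (p_hat_l \<mu> q s)" and ?ph = "high_price \<mu> q \<beta> s"
  note pl = low_price_maximizes and ph = high_price_maximizes
  have fl: "low_value ?pl \<le> worst_case ?pl" using low_value_le_worst_case pl by simp
  have fh: "high_value ?ph \<le> worst_case ?ph" using high_value_le_worst_case ph by simp
  have ph_pos: "0 < worst_case ?ph"
    using fh ph(1,2) share_pos[of ?ph] beta_pos by (simp add: high_value_def min_def split: if_splits)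
      (meson divide_pos_pos less_le_trans)
  have beaten: "worst_case p < max (worst_case ?pl) (worst_case ?ph)" if p: "0 < p" "p \<noteq> ?pl" "p \<noteq> ?ph" for p
  proof -
    \<comment> \<open>In each range the exact formula is compared with the global lower bound at its maximiser.\<close>
    consider "p < \<mu>" "\<alpha> p \<le> \<beta>" | "p < \<tau>" "p < \<mu> \<Longrightarrow> \<beta> < \<alpha> p" | "\<tau> \<le> p" by linarith
    then show ?thesis
    proof cases
      case 1
      then have "worst_case p < worst_case ?pl" using worst_case_le_low_value[of p] pl(3)[of p] fl p by linarith
      then show ?thesis by simp
    next
      case 2
      then have "worst_case p < worst_case ?ph" using worst_case_le_high_value[of p] ph(3)[of p] fh p by fastforce
      then show ?thesis by simp
    next
      case 3
      then show ?thesis using worst_case_nonpos_above_tau[of p] ph_pos by simp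
    qed
  qed
  define best where "best = (if worst_case ?ph \<le> worst_case ?pl then ?pl else ?ph)"
  have best: "0 < best" "worst_case best = max (worst_case ?pl) (worst_case ?ph)"
    using pl(1) ph(1) by (auto simp: best_def)
  have "worst_case y \<le> worst_case best" if "0 < y" for y
    using beaten[OF that] best(2) by (cases "y = ?pl"; cases "y = ?ph") auto
  then have "\<not> (\<exists>y. 0 < y \<and> worst_case best < worst_case y)" by (meson not_less)
  then have "best \<in> optimal_robust_prices \<mu> q \<beta> s"
    using best(1) by (simp add: optimal_robust_prices_def is_arg_max_def)
  moreover have "p \<in> {?pl, ?ph}" if "p \<in> optimal_robust_prices \<mu> q \<beta> s" for p
  proof -
    have "0 < p" "\<not> worst_case p < worst_case best"
      using that best(1) by (auto simp: optimal_robust_prices_def is_arg_max_def)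
    then show ?thesis using beaten[of p] best(2) by auto
  qed
  ultimately show ?thesis by blast
qed

end
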